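(* There exists a subshift $X\subseteq\{0,1\}^{\mathbb{Z}}$ such that the $\mathbb{Z}$-system $(X,\sigma)$ is chaotic almost minimal (CAM), and $(X,\sigma)$ supports at least two distinct nonatomic ergodic $\sigma$-invariant Borel probability measures.
   Context: Let $G$ be a countable discrete group. A topological $G$-system $(X,T)$ consists of a compact metric space $X$ and an action $T\colon G\to\mathrm{Homeo}(X)$, $g\mapsto T_g$. A $\mathbb{Z}$-system is given by a single homeomorphism $T$ (with $T_n=T^n$). The system is topologically transitive if for all nonempty open $U,V\subseteq X$ there is $g\in G$ with $T_gU\cap V\neq\emptyset$; the action is faithful if $T_g=\mathrm{id}_X$ only when $g$ is the identity. A point is periodic if its $G$-orbit is finite. The system is chaotic almost minimal (CAM) if: (1) it is topologically transitive and the action is faithful; (2) the periodic points are dense in $X$; (3) every proper closed $T$-invariant subset of $X$ is finite. A subshift is a closed subset $X\subseteq\{0,1\}^{\mathbb{Z}}$ invariant under the left shift $(\sigma x)_n=x_{n+1}$, with the product topology. *)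

theory Defs
  imports "HOL-Analysis.Analysis" "HOL-Probability.Probability"
begin

text \<open>Points of the full shift {0,1}^Z are functions int => bool (False = 0, True = 1);
  the type carries the product topology (bool has the discrete order topology).\<close>

definition shiftp :: "int \<Rightarrow> (int \<Rightarrow> bool) \<Rightarrow> (int \<Rightarrow> bool)" where
  "shiftp n x = (\<lambda>k. x (k + n))"

abbreviation shift :: "(int \<Rightarrow> bool) \<Rightarrow> (int \<Rightarrow> bool)" where
  "shift \<equiv> shiftp 1"

definition subshift :: "(int \<Rightarrow> bool) set \<Rightarrow> bool" where
  "subshift X \<longleftrightarrow> closed X \<and> shift ` X = X"

definition top_transitive :: "(int \<Rightarrow> bool) set \<Rightarrow> bool" where
  "top_transitive X \<longleftrightarrow>
     (\<forall>U V. openin (top_of_set X) U \<and> openin (top_of_set X) V \<and> U \<noteq> {} \<and> V \<noteq> {}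
        \<longrightarrow> (\<exists>n::int. shiftp n ` U \<inter> V \<noteq> {}))"

definition faithful :: "(int \<Rightarrow> bool) set \<Rightarrow> bool" where
  "faithful X \<longleftrightarrow> (\<forall>n::int. (\<forall>x\<in>X. shiftp n x = x) \<longrightarrow> n = 0)"

definition orbit :: "(int \<Rightarrow> bool) \<Rightarrow> (int \<Rightarrow> bool) set" where
  "orbit x = range (\<lambda>n. shiftp n x)"

definition periodic_points :: "(int \<Rightarrow> bool) set \<Rightarrow> (int \<Rightarrow> bool) set" where
  "periodic_points X = {x\<in>X. finite (orbit x)}"

definition CAM :: "(int \<Rightarrow> bool) set \<Rightarrow> bool" where
  "CAM X \<longleftrightarrow>
     top_transitive X \<and> faithful X \<and>
     X \<subseteq> closure (periodic_points X) \<and>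
     (\<forall>A. A \<subset> X \<and> closed A \<and> (\<forall>n::int. shiftp n ` A \<subseteq> A) \<longrightarrow> finite A)"

definition borel_prob_on :: "(int \<Rightarrow> bool) set \<Rightarrow> (int \<Rightarrow> bool) measure \<Rightarrow> bool" where
  "borel_prob_on X \<mu> \<longleftrightarrow> prob_space \<mu> \<and> sets \<mu> = sets (restrict_space borel X)"

definition shift_invariant :: "(int \<Rightarrow> bool) measure \<Rightarrow> bool" where
  "shift_invariant \<mu> \<longleftrightarrow>
     (\<forall>A\<in>sets \<mu>. shift -` A \<inter> space \<mu> \<in> sets \<mu> \<and>
                 emeasure \<mu> (shift -` A \<inter> space \<mu>) = emeasure \<mu> A)"

definition shift_ergodic :: "(int \<Rightarrow> bool) measure \<Rightarrow> bool" where
  "shift_ergodic \<mu> \<longleftrightarrow>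
     (\<forall>A\<in>sets \<mu>. shift -` A \<inter> space \<mu> = A \<longrightarrow> emeasure \<mu> A = 0 \<or> emeasure \<mu> A = 1)"

definition nonatomic :: "(int \<Rightarrow> bool) measure \<Rightarrow> bool" where
  "nonatomic \<mu> \<longleftrightarrow> (\<forall>x\<in>space \<mu>. emeasure \<mu> {x} = 0)"

definition ergodic_nonatomic_on :: "(int \<Rightarrow> bool) set \<Rightarrow> (int \<Rightarrow> bool) measure \<Rightarrow> bool" where
  "ergodic_nonatomic_on X \<mu> \<longleftrightarrow>
     borel_prob_on X \<mu> \<and> shift_invariant \<mu> \<and> shift_ergodic \<mu> \<and> nonatomic \<mu>"

end

theory Submission
  imports Defs
begin

text \<open>
  Starting from the words 0 and 1, two words of equal length are grown at each level: the next word
  \<open>block (Suc n) c\<close> consists of an enormous number of copies of \<open>block n c\<close> followed by a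
  \<open>spacer\<close>, common to both values of \<open>c\<close>, which contains high powers of all earlier words, any two
  of these powers being separated by a word of level \<open>n\<close>.  The subshift is the closure of the orbits
  of the periodic points generated by these words, so periodic points are dense.

  A closed invariant set that is not the whole space misses some finite pattern, hence all words of
  some level \<open>r\<close>.  In a point of the subshift, whatever lies between neighbouring words of
  level \<open>r\<close> is a stretch of one of the finitely many periodic orbits of level below \<open>r\<close>; a point
  without words of level \<open>r\<close> is therefore itself on such an orbit, and the set is finite.

  For fixed \<open>c\<close> the periodic orbit measures of \<open>block n c\<close> converge.  With respect to the limit,
  up to an error that tends to 0 with \<open>n\<close>, a point looks locally like the periodic point of level
  \<open>n\<close>, so its average over a window of one period is the frequency along that periodic orbit.  This
  makes every invariant set independent of every clopen set, whence ergodicity.  The limits for the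
  two values of \<open>c\<close> differ because the density of 1 stays within 1/3 of its initial value.
\<close>

section \<open>The topology of the full shift\<close>

text \<open>Plays the role of a metric: the cylinders \<open>{y. agree k x y}\<close> are a
  neighbourhood base at \<open>x\<close>, and the topological arguments below are reduced to them.
  For negative \<open>k\<close> the condition is vacuous.\<close>

definition agree :: "int \<Rightarrow> (int \<Rightarrow> bool) \<Rightarrow> (int \<Rightarrow> bool) \<Rightarrow> bool" where
  "agree k x y \<longleftrightarrow> (\<forall>i. \<bar>i\<bar> \<le> k \<longrightarrow> x i = y i)"

lemma agree_refl [simp]: "agree k x x"
  by (simp add: agree_def)

lemma agree_sym: "agree k x y \<Longrightarrow> agree k y x"
  by (simp add: agree_def)

lemma agree_trans: "agree k x y \<Longrightarrow> agree k y z \<Longrightarrow> agree k x z"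
  by (simp add: agree_def)

lemma agree_mono: "agree k x y \<Longrightarrow> l \<le> k \<Longrightarrow> agree l x y"
  by (simp add: agree_def)

lemma agree_shiftp: "agree k x y \<Longrightarrow> l + \<bar>j\<bar> \<le> k \<Longrightarrow> agree l (shiftp j x) (shiftp j y)"
  by (auto simp: agree_def shiftp_def)

lemma shiftp_shiftp [simp]: "shiftp i (shiftp j x) = shiftp (i + j) x"
  by (simp add: shiftp_def algebra_simps)

lemma shiftp_0 [simp]: "shiftp 0 x = x"
  by (simp add: shiftp_def)

lemma open_agree: "open {y. agree k x y}"
proof -
  have "open {f. \<forall>i\<in>{-k..k}. f i \<in> {x i}}"
    by (rule product_topology_basis'[where x = "\<lambda>i. i"]) (auto intro: Topological_Spaces.open_discrete)
  also have "{f. \<forall>i\<in>{-k..k}. f i \<in> {x i}} = {y. agree k x y}"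
    by (auto simp: agree_def abs_le_iff)
  finally show ?thesis .
qed

text \<open>A basic open set of the product topology restricts only finitely many coordinates, so
  some central window contains all of them.\<close>

lemma open_iff_agree:
  fixes U :: "(int \<Rightarrow> bool) set"
  shows "open U \<longleftrightarrow> (\<forall>x\<in>U. \<exists>k. \<forall>y. agree k x y \<longrightarrow> y \<in> U)"
proof
  assume U: "open U"
  show "\<forall>x\<in>U. \<exists>k. \<forall>y. agree k x y \<longrightarrow> y \<in> U"
  proof
    fix x assume "x \<in> U"
    moreover have "openin (product_topology (\<lambda>i. euclidean) UNIV) U"
      using U by (simp add: open_fun_def)
    ultimately obtain V where V: "x \<in> (\<Pi>\<^sub>E i\<in>UNIV. V i)"
        "finite {i. V i \<noteq> (UNIV :: bool set)}" "(\<Pi>\<^sub>E i\<in>UNIV. V i) \<subseteq> U"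
      using product_topology_open_contains_basis[of "\<lambda>i. euclidean" UNIV U x] by auto
    \<comment> \<open>The sum dominates each of its terms and, unlike a maximum, has a sensible
      value when no coordinate is restricted.\<close>
    define k where "k = (\<Sum>i\<in>{i. V i \<noteq> UNIV}. \<bar>i\<bar>)"
    have k: "\<bar>i\<bar> \<le> k" if "V i \<noteq> UNIV" for i
      unfolding k_def using V(2) that by (intro member_le_sum) auto
    have "y \<in> U" if "agree k x y" for y
    proof -
      have "y i \<in> V i" for i
      proof (cases "V i = UNIV")
        case False
        then have "x i = y i" using k that by (auto simp: agree_def)
        moreover have "x i \<in> V i" using V(1) by auto
        ultimately show ?thesis by simp
      qed auto
      then show ?thesis using V(3) by auto
    qed
    then show "\<exists>k. \<forall>y. agree k x y \<longrightarrow> y \<in> U" by blast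
  qed
next
  assume R: "\<forall>x\<in>U. \<exists>k. \<forall>y. agree k x y \<longrightarrow> y \<in> U"
  show "open U"
    by (subst open_subopen) (metis R agree_refl mem_Collect_eq open_agree subsetI)
qed

lemma closure_iff_agree:
  fixes S :: "(int \<Rightarrow> bool) set"
  shows "x \<in> closure S \<longleftrightarrow> (\<forall>k. \<exists>y\<in>S. agree k x y)"
proof
  assume x: "x \<in> closure S"
  show "\<forall>k. \<exists>y\<in>S. agree k x y"
  proof
    fix k
    have "S \<inter> {y. agree k x y} \<noteq> {}"
      using x open_Int_closure_eq_empty[OF open_agree[of k x], of S] agree_refl[of k x] by blast
    then show "\<exists>y\<in>S. agree k x y" by blast
  qed
next
  assume R: "\<forall>k. \<exists>y\<in>S. agree k x y"
  show "x \<in> closure S"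
  proof (rule ccontr)
    assume "x \<notin> closure S"
    then obtain k where "\<forall>y. agree k x y \<longrightarrow> y \<in> - closure S"
      using open_iff_agree[of "- closure S"] by auto
    then show False using R closure_subset by blast
  qed
qed

lemma closed_finite_full_shift:
  fixes F :: "(int \<Rightarrow> bool) set"
  assumes "finite F"
  shows "closed F"
proof -
  have "closed {x}" for x :: "int \<Rightarrow> bool"
  proof -
    have "\<exists>k. \<forall>z. agree k y z \<longrightarrow> z \<in> - {x}" if y: "y \<in> - {x}" for y
    proof -
      obtain i where "y i \<noteq> x i" using y by auto
      then show ?thesis by (intro exI[of _ "\<bar>i\<bar>"]) (auto simp: agree_def)
    qed
    then show ?thesis by (simp add: closed_def open_iff_agree)
  qed
  then have "closed (\<Union>x\<in>F. {x})" using assms by (intro closed_UN) auto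
  then show ?thesis by simp
qed

lemma compact_full_shift: "compact (UNIV :: (int \<Rightarrow> bool) set)"
proof -
  have "compact_space (product_topology (\<lambda>i::int. (euclidean :: bool topology)) UNIV)"
    by (subst compact_space_product_topology)
      (simp add: compact_space_def compactin_euclidean_iff finite_imp_compact)
  then show ?thesis
    by (simp add: compact_space_def euclidean_product_topology compactin_euclidean_iff)
qed

section \<open>Sets determined by finitely many coordinates: the algebra of clopen sets\<close>

definition local_sets :: "int \<Rightarrow> (int \<Rightarrow> bool) set set" where
  "local_sets k = {C. \<forall>x y. agree k x y \<longrightarrow> x \<in> C \<longrightarrow> y \<in> C}"

lemma local_setsD: "C \<in> local_sets k \<Longrightarrow> agree k x y \<Longrightarrow> x \<in> C \<longleftrightarrow> y \<in> C"
  unfolding local_sets_def using agree_sym by blast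

lemma local_sets_mono: "C \<in> local_sets k \<Longrightarrow> k \<le> l \<Longrightarrow> C \<in> local_sets l"
  unfolding local_sets_def by (blast intro: agree_mono)

lemma local_sets_open: "C \<in> local_sets k \<Longrightarrow> open C"
  unfolding open_iff_agree local_sets_def by blast

lemma local_sets_Compl: "C \<in> local_sets k \<Longrightarrow> - C \<in> local_sets k"
  unfolding local_sets_def by (auto dest: agree_sym)

lemma local_sets_Un: "C \<in> local_sets k \<Longrightarrow> D \<in> local_sets k \<Longrightarrow> C \<union> D \<in> local_sets k"
  unfolding local_sets_def by blast

lemma local_sets_closed: "C \<in> local_sets k \<Longrightarrow> closed C"
  using local_sets_open[OF local_sets_Compl] by (simp add: closed_def)

lemma local_sets_shiftp: "C \<in> local_sets k \<Longrightarrow> k + \<bar>j\<bar> \<le> l \<Longrightarrow> shiftp j -` C \<in> local_sets l"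
  unfolding local_sets_def by (auto intro: agree_shiftp)

lemma agree_in_local_sets: "{y. agree k x y} \<in> local_sets k"
  unfolding local_sets_def using agree_trans by blast

definition clopens :: "(int \<Rightarrow> bool) set set" where
  "clopens = (\<Union>k. local_sets k)"

lemma clopensE2:
  assumes "C \<in> clopens" "D \<in> clopens"
  obtains k where "C \<in> local_sets k" "D \<in> local_sets k"
proof -
  obtain k l where "C \<in> local_sets k" "D \<in> local_sets l"
    using assms by (auto simp: clopens_def)
  then have "C \<in> local_sets (max k l)" "D \<in> local_sets (max k l)"
    by (auto intro: local_sets_mono)
  then show ?thesis by (rule that)
qed

lemma algebra_clopens: "algebra UNIV clopens"
proof (unfold algebra_iff_Un, intro conjI ballI)
  show "{} \<in> clopens" by (auto simp: clopens_def local_sets_def)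
  show "UNIV - C \<in> clopens" if "C \<in> clopens" for C
    using that by (auto simp: clopens_def Compl_eq_Diff_UNIV[symmetric] dest: local_sets_Compl)
  show "C \<union> D \<in> clopens" if "C \<in> clopens" "D \<in> clopens" for C D
    using clopensE2[OF that] by (metis UN_I UNIV_I clopens_def local_sets_Un)
qed auto

lemma clopens_Int: "C \<in> clopens \<Longrightarrow> D \<in> clopens \<Longrightarrow> C \<inter> D \<in> clopens"
  using algebra_clopens by (metis algebra_iff_Int)

lemma Int_stable_clopens: "Int_stable clopens"
  by (auto simp: Int_stable_def clopens_Int)

text \<open>A cylinder is coded by its radius together with the finite set of positions in its
  window that carry a 1.\<close>

lemma countable_cylinders: "countable (range (\<lambda>(k, x). {y. agree k x y}))"
proof -
  define c where "c = (\<lambda>(k::int, s::int set). {y. \<forall>i. \<bar>i\<bar> \<le> k \<longrightarrow> y i = (i \<in> s)})"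
  have "{y. agree k x y} \<in> c ` (UNIV \<times> {s. finite s})" for k x
  proof
    have "{i. \<bar>i\<bar> \<le> k} = {-k..k}" by auto
    then show "(k, {i. \<bar>i\<bar> \<le> k \<and> x i}) \<in> UNIV \<times> {s. finite s}"
      by simp
  qed (auto simp: c_def agree_def)
  then have "range (\<lambda>(k, x). {y. agree k x y}) \<subseteq> c ` (UNIV \<times> {s. finite s})"
    by auto
  moreover have "countable ((UNIV :: int set) \<times> {s :: int set. finite s})"
    by (intro countable_SIGMA) (auto intro: countable_Collect_finite countableI_type)
  ultimately show ?thesis
    by (metis countable_image countable_subset)
qed

lemma open_countable_Union_clopens:
  assumes U: "open U"
  obtains F where "countable F" "F \<subseteq> clopens" "\<Union>F = U"
proof
  define F where "F = {C \<in> range (\<lambda>(k, x). {y. agree k x y}). C \<subseteq> U}"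
  show "countable F"
    unfolding F_def by (rule countable_subset[OF _ countable_cylinders]) auto
  show "F \<subseteq> clopens"
  proof
    fix C assume "C \<in> F"
    then obtain k x where "C = {y. agree k x y}" by (auto simp: F_def)
    then show "C \<in> clopens" using agree_in_local_sets by (simp add: clopens_def) blast
  qed
  show "\<Union>F = U"
  proof
    show "U \<subseteq> \<Union>F"
    proof
      fix x assume "x \<in> U"
      then obtain k where "\<forall>y. agree k x y \<longrightarrow> y \<in> U"
        using U by (auto simp: open_iff_agree)
      then have "{y. agree k x y} \<in> F" by (auto simp: F_def)
      then show "x \<in> \<Union>F" by (rule UnionI) simp
    qed
  qed (auto simp: F_def)
qed

section \<open>Borel sets and the construction of measures from clopen sets\<close>

lemma clopens_borel: "C \<in> clopens \<Longrightarrow> C \<in> sets borel"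
  by (auto simp: clopens_def intro: borel_open local_sets_open)

lemma sigma_sets_clopens: "sigma_sets UNIV clopens = sets borel"
proof
  have "clopens \<subseteq> sets borel"
    by (auto intro: clopens_borel)
  then show "sigma_sets UNIV clopens \<subseteq> sets borel"
    by (metis sets.sigma_sets_subset space_borel)
  have "U \<in> sigma_sets UNIV clopens" if U: "open U" for U
  proof -
    obtain F where F: "countable F" "F \<subseteq> clopens" "\<Union>F = U"
      by (rule open_countable_Union_clopens[OF U])
    then have "\<Union>F \<in> sigma_sets UNIV clopens"
      by (intro sigma_sets_UNION) auto
    then show ?thesis using F by simp
  qed
  then show "sets borel \<subseteq> sigma_sets UNIV clopens"
    unfolding borel_def by (simp add: sets_measure_of) (rule sigma_sets_mono, auto)
qed

lemma shiftp_measurable [measurable]: "shiftp n \<in> borel \<rightarrow>\<^sub>M borel"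
proof (rule borel_measurable_continuous_onI)
  have "open (shiftp n -` U)" if U: "open U" for U
    unfolding open_iff_agree
  proof
    fix x assume "x \<in> shiftp n -` U"
    then obtain k where "\<forall>y. agree k (shiftp n x) y \<longrightarrow> y \<in> U"
      using U unfolding open_iff_agree by fastforce
    then show "\<exists>k. \<forall>y. agree k x y \<longrightarrow> y \<in> shiftp n -` U"
      by (intro exI[of _ "k + \<bar>n\<bar>"]) (auto intro: agree_shiftp)
  qed
  then show "continuous_on UNIV (shiftp n)"
    by (simp add: continuous_on_open_vimage)
qed

text \<open>Caratheodory extension. Continuity at the empty set comes from compactness: a decreasing
  sequence of clopen sets with empty intersection is eventually empty, so finite additivity is
  enough.\<close>

lemma measure_extension_clopens:
  fixes f :: "(int \<Rightarrow> bool) set \<Rightarrow> real"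
  assumes nonneg: "\<And>C. C \<in> clopens \<Longrightarrow> 0 \<le> f C" and one: "f UNIV = 1"
    and add: "\<And>C D. C \<in> clopens \<Longrightarrow> D \<in> clopens \<Longrightarrow> C \<inter> D = {} \<Longrightarrow> f (C \<union> D) = f C + f D"
  obtains M where "prob_space M" "sets M = sets borel"
    "\<And>C. C \<in> clopens \<Longrightarrow> measure M C = f C"
proof -
  interpret algebra UNIV clopens by (rule algebra_clopens)
  have empty: "f {} = 0"
    using add[of "{}" "{}"] by simp
  have "\<exists>\<mu>. (\<forall>s\<in>clopens. \<mu> s = ennreal (f s)) \<and> measure_space UNIV (sigma_sets UNIV clopens) \<mu>"
  proof (rule caratheodory_empty_continuous)
    show "positive clopens (\<lambda>s. ennreal (f s))"
      using empty by (simp add: positive_def)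
    show "additive clopens (\<lambda>s. ennreal (f s))"
      by (auto simp: additive_def add nonneg ennreal_plus)
    fix C :: "nat \<Rightarrow> (int \<Rightarrow> bool) set"
    assume C: "range C \<subseteq> clopens" "decseq C" "(\<Inter>i. C i) = {}"
    have "\<exists>i. C i = {}"
    proof (rule ccontr)
      assume ne: "\<not> (\<exists>i. C i = {})"
      have cl: "closed (C i)" for i
      proof -
        have "C i \<in> clopens" using C(1) by blast
        then show ?thesis by (auto simp: clopens_def intro: local_sets_closed)
      qed
      have "UNIV \<inter> (\<Inter>i. C i) \<noteq> {}"
      proof (rule compact_imp_fip_image[OF compact_full_shift])
        fix I :: "nat set" assume I: "finite I" "I \<subseteq> UNIV"
        \<comment> \<open>Inserting 0 keeps the maximum meaningful when \<open>I\<close> is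
          empty.\<close>
        have "C (Max (insert 0 I)) \<subseteq> (\<Inter>i\<in>I. C i)"
          using I(1) by (intro INT_greatest decseqD[OF C(2)] Max_ge; simp)
        then show "UNIV \<inter> (\<Inter>i\<in>I. C i) \<noteq> {}" using ne by auto
      qed (rule cl)
      then show False using C(3) by simp
    qed
    then obtain i where i: "C i = {}" by blast
    have "C j = {}" if "i \<le> j" for j
      using i decseqD[OF C(2) that] by simp
    then have "\<forall>\<^sub>F j in sequentially. ennreal (f (C j)) = 0"
      by (intro eventually_sequentiallyI[of i]) (simp add: empty)
    then show "(\<lambda>i. ennreal (f (C i))) \<longlonglongrightarrow> 0"
      by (rule tendsto_eventually)
  qed simp
  then obtain \<mu> where \<mu>: "\<And>s. s \<in> clopens \<Longrightarrow> \<mu> s = ennreal (f s)"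
    and ms: "measure_space UNIV (sigma_sets UNIV clopens) \<mu>" by blast
  define M where "M = measure_of UNIV clopens \<mu>"
  have sets: "sets M = sets borel"
    by (simp add: M_def sigma_sets_clopens)
  have em: "emeasure M C = ennreal (f C)" if "C \<in> clopens" for C
  proof -
    have "emeasure M C = \<mu> C"
    proof (rule emeasure_measure_of[OF M_def])
      show "C \<in> sets M" using that by (simp add: sets clopens_borel)
      have "sets M = sigma_sets UNIV clopens" by (simp only: sets sigma_sets_clopens)
      then show "positive (sets M) \<mu>" "countably_additive (sets M) \<mu>"
        using ms by (auto simp: measure_space_def)
    qed simp
    then show ?thesis using \<mu> that by simp
  qed
  show ?thesis
  proof (rule that[OF _ sets])
    have "space M = UNIV" by (simp add: M_def)
    then show "prob_space M" using em[OF top] one by (intro prob_spaceI) simp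
    show "measure M C = f C" if "C \<in> clopens" for C
      using em[OF that] nonneg[OF that] by (simp add: measure_def)
  qed
qed

section \<open>Limits of periodic orbit measures\<close>

text \<open>Moving the window by one trades its first term for the one just beyond its end, and
  these are equal by periodicity; induction runs in both directions over the integers.\<close>

lemma periodic_sum_shift:
  fixes f :: "int \<Rightarrow> real"
  assumes per: "\<And>k. f (k + int l) = f k"
  shows "(\<Sum>j<l. f (int j + i)) = (\<Sum>j<l. f (int j))"
proof -
  have step: "(\<Sum>j<l. f (int j + (i + 1))) = (\<Sum>j<l. f (int j + i))" for i
  proof -
    have "(\<Sum>j<Suc l. f (int j + i)) = f i + (\<Sum>j<l. f (int j + (i + 1)))"
      by (simp only: sum.lessThan_Suc_shift) (simp add: algebra_simps)
    moreover have "(\<Sum>j<Suc l. f (int j + i)) = (\<Sum>j<l. f (int j + i)) + f i"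
      using per[of i] by (simp add: algebra_simps)
    ultimately show ?thesis by simp
  qed
  show ?thesis
  proof (induction i rule: int_induct[where k = 0])
    case (step2 i)
    then show ?case using step[of "i - 1"] by simp
  qed (use step in simp_all)
qed

text \<open>If \<open>l\<close> is a period of \<open>x\<close>, this is the mass of
  \<open>C\<close> under the uniform measure on the orbit of \<open>x\<close>; \<open>l\<close> may
  be any positive period, not only the least one.\<close>

definition freq :: "(int \<Rightarrow> bool) \<Rightarrow> nat \<Rightarrow> (int \<Rightarrow> bool) set \<Rightarrow> real" where
  "freq x l C = (\<Sum>j<l. indicator C (shiftp (int j) x)) / real l"

text \<open>The bad set: points that do not look locally like the orbit of \<open>x\<close>. The
  radius is \<open>2 * int l\<close> so that after any shift by less than \<open>l\<close> an
  agreement of radius \<open>l\<close> is still left.\<close>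

definition unlike :: "(int \<Rightarrow> bool) \<Rightarrow> nat \<Rightarrow> (int \<Rightarrow> bool) set" where
  "unlike x l = {y. \<forall>i. \<not> agree (2 * int l) y (shiftp i x)}"

lemma unlike_local: "unlike x l \<in> local_sets (2 * int l)"
  unfolding unlike_def local_sets_def by (auto dest: agree_trans)

lemma freq_nonneg: "0 \<le> freq x l C"
  unfolding freq_def by (intro divide_nonneg_nonneg sum_nonneg) auto

lemma freq_UNIV: "0 < l \<Longrightarrow> freq x l UNIV = 1"
  by (simp add: freq_def)

lemma freq_Un: "C \<inter> D = {} \<Longrightarrow> freq x l (C \<union> D) = freq x l C + freq x l D"
  unfolding freq_def
  by (simp add: indicator_add[symmetric] sum.distrib add_divide_distrib)

lemma sum_indicator_shiftp:
  fixes C :: "(int \<Rightarrow> bool) set"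
  assumes "shiftp (int l) x = x"
  shows "(\<Sum>j<l. indicator C (shiftp (int j + i) x) :: real) = (\<Sum>j<l. indicator C (shiftp (int j) x))"
proof (rule periodic_sum_shift)
  show "indicator C (shiftp (k + int l) x) = (indicator C (shiftp k x) :: real)" for k
  proof -
    have "shiftp (k + int l) x = shiftp k x"
      using arg_cong[OF assms, of "shiftp k"] by simp
    then show ?thesis by simp
  qed
qed

lemma freq_shiftp:
  assumes "shiftp (int l) x = x"
  shows "freq x l (shiftp i -` C) = freq x l C"
  using sum_indicator_shiftp[OF assms, of C i]
  by (simp add: freq_def indicator_def add.commute)

lemma sum_indicator_not_unlike:
  assumes "shiftp (int l) x = x" "y \<notin> unlike x l" "C \<in> local_sets (int l)"
  shows "(\<Sum>j<l. indicator C (shiftp (int j) y)) = real l * freq x l C"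
proof -
  obtain i where i: "agree (2 * int l) y (shiftp i x)"
    using assms(2) by (auto simp: unlike_def)
  have "indicator C (shiftp (int j) y) = (indicator C (shiftp (int j + i) x) :: real)" if "j < l" for j
  proof -
    have "agree (int l) (shiftp (int j) y) (shiftp (int j) (shiftp i x))"
      using that by (intro agree_shiftp[OF i]) auto
    then show ?thesis
      using local_setsD[OF assms(3)] by (simp add: indicator_def)
  qed
  then have "(\<Sum>j<l. indicator C (shiftp (int j) y)) = (\<Sum>j<l. indicator C (shiftp (int j + i) x) :: real)"
    by simp
  also have "\<dots> = real l * freq x l C"
    by (simp add: sum_indicator_shiftp[OF assms(1)] freq_def)
  finally show ?thesis .
qed

text \<open>Off the bad set the window of length \<open>l\<close> runs through exactly one period of
  \<open>x\<close>, so the difference is 0. On the bad set both numbers lie in [0, 1].\<close>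

lemma window_average:
  assumes per: "shiftp (int l) x = x" and l: "0 < l" and C: "C \<in> local_sets (int l)"
  shows "\<bar>(\<Sum>j<l. indicator C (shiftp (int j) y)) / real l - freq x l C\<bar> \<le> indicator (unlike x l) y"
proof (cases "y \<in> unlike x l")
  case False
  then show ?thesis using sum_indicator_not_unlike[OF per False C] l by simp
next
  case True
  have *: "0 \<le> (\<Sum>j<l. indicator C (shiftp (int j) y)) / real l"
    "(\<Sum>j<l. indicator C (shiftp (int j) y)) / real l \<le> 1" for y
  proof -
    show "0 \<le> (\<Sum>j<l. indicator C (shiftp (int j) y)) / real l"
      by (intro divide_nonneg_nonneg sum_nonneg) auto
    have "(\<Sum>j<l. indicator C (shiftp (int j) y)) \<le> (\<Sum>j<l. 1::real)"
      by (intro sum_mono) (auto simp: indicator_def)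
    then show "(\<Sum>j<l. indicator C (shiftp (int j) y)) / real l \<le> 1"
      using l by (simp add: divide_le_eq)
  qed
  show ?thesis using True *[of x] *[of y] by (simp add: freq_def)
qed

text \<open>Averaging the window averages of \<open>C\<close> along the orbit of \<open>x'\<close>
  gives back the frequency of \<open>C\<close> along that orbit, by exchanging the two sums. The
  bound then follows by averaging \<open>window_average\<close>.\<close>

lemma freq_close:
  assumes per: "shiftp (int l) x = x" and l: "0 < l" and C: "C \<in> local_sets (int l)"
    and per': "shiftp (int l') x' = x'" and l': "0 < l'"
  shows "\<bar>freq x' l' C - freq x l C\<bar> \<le> freq x' l' (unlike x l)"
proof -
  define g where "g = (\<lambda>y. (\<Sum>j<l. indicator C (shiftp (int j) y)) / real l)"
  have "(\<Sum>i<l'. g (shiftp (int i) x')) = (\<Sum>i<l'. \<Sum>j<l. indicator C (shiftp (int i + int j) x')) / real l"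
    by (simp add: g_def sum_divide_distrib add.commute)
  also have "\<dots> = (\<Sum>j<l. \<Sum>i<l'. indicator C (shiftp (int i + int j) x')) / real l"
    by (subst sum.swap) simp
  also have "\<dots> = real l' * freq x' l' C"
    using l l' by (simp add: sum_indicator_shiftp[OF per'] freq_def)
  finally have "real l' * (freq x' l' C - freq x l C) = (\<Sum>i<l'. g (shiftp (int i) x') - freq x l C)"
    by (simp add: sum_subtractf algebra_simps)
  also have "\<bar>\<dots>\<bar> \<le> (\<Sum>i<l'. \<bar>g (shiftp (int i) x') - freq x l C\<bar>)"
    by (rule sum_abs)
  also have "\<dots> \<le> (\<Sum>i<l'. indicator (unlike x l) (shiftp (int i) x'))"
    unfolding g_def by (intro sum_mono window_average assms)
  finally show ?thesis
    using l' by (simp add: freq_def abs_mult le_divide_eq mult.commute)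
qed

text \<open>Abstracts what the measure theory uses of the block construction. \<open>l_gt\<close>
  makes each clopen set eventually local at radius \<open>l n\<close>. In \<open>aperiodic\<close>
  the bound \<open>1 / real (l n)\<close> is the frequency of one position in a period: a pattern
  that the \<open>n\<close>-th point shows even once keeps positive mass in the limit when
  \<open>\<delta> n\<close> is smaller.\<close>

locale periodic_approximation =
  fixes p :: "nat \<Rightarrow> int \<Rightarrow> bool" and l :: "nat \<Rightarrow> nat" and \<delta> :: "nat \<Rightarrow> real"
  assumes period: "shiftp (int (l n)) (p n) = p n"
    and l_gt: "n < l n"
    and \<delta>_lim: "\<delta> \<longlonglongrightarrow> 0"
    and freq_unlike: "n \<le> m \<Longrightarrow> freq (p m) (l m) (unlike (p n) (l n)) \<le> \<delta> n"
    and aperiodic: "0 < q \<Longrightarrow> \<exists>n\<ge>q. \<delta> n < 1 / real (l n) \<and> (\<exists>j. p n (j + int q) \<noteq> p n j)"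
begin

abbreviation fr :: "nat \<Rightarrow> (int \<Rightarrow> bool) set \<Rightarrow> real" where
  "fr n \<equiv> freq (p n) (l n)"

lemma l_pos: "0 < l n"
  using l_gt[of n] by simp

lemma fr_close: "n \<le> m \<Longrightarrow> C \<in> local_sets (int (l n)) \<Longrightarrow> \<bar>fr m C - fr n C\<bar> \<le> \<delta> n"
  using freq_close[OF period l_pos _ period l_pos] freq_unlike by (meson order_trans)

lemma clopens_eventually_local:
  assumes "C \<in> clopens"
  shows "\<forall>\<^sub>F n in sequentially. C \<in> local_sets (int (l n))"
proof -
  obtain k where k: "C \<in> local_sets k" using assms by (auto simp: clopens_def)
  show ?thesis
  proof (rule eventually_sequentiallyI[of "nat k"])
    fix n assume "nat k \<le> n"
    then have "k \<le> int (l n)" using l_gt[of n] by linarith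
    then show "C \<in> local_sets (int (l n))" by (rule local_sets_mono[OF k])
  qed
qed

text \<open>All frequencies from index \<open>n\<close> on lie within \<open>\<delta> n\<close> of
  the \<open>n\<close>-th one, so the sequence is Cauchy.\<close>

lemma fr_convergent:
  assumes "C \<in> clopens"
  shows "convergent (\<lambda>n. fr n C)"
proof (rule Cauchy_convergent, rule metric_CauchyI)
  fix e :: real assume "0 < e"
  then have "\<forall>\<^sub>F n in sequentially. \<delta> n < e / 2"
    using order_tendstoD(2)[OF \<delta>_lim, of "e / 2"] by simp
  then obtain n where n: "\<delta> n < e / 2" "C \<in> local_sets (int (l n))"
    using eventually_happens[OF eventually_conj[OF _ clopens_eventually_local[OF assms]]] by auto
  have "dist (fr i C) (fr j C) < e" if "n \<le> i" "n \<le> j" for i j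
    using fr_close[OF that(1) n(2)] fr_close[OF that(2) n(2)] n(1) by (simp add: dist_real_def)
  then show "\<exists>M. \<forall>i\<ge>M. \<forall>j\<ge>M. dist (fr i C) (fr j C) < e" by blast
qed

end

locale periodic_limit_measure = periodic_approximation p l \<delta> + prob_space M
  for p l \<delta> and M :: "(int \<Rightarrow> bool) measure" +
  assumes sets_M: "sets M = sets borel"
    and fr_lim: "C \<in> clopens \<Longrightarrow> (\<lambda>n. fr n C) \<longlonglongrightarrow> measure M C"

text \<open>The limiting frequencies inherit positivity, normalisation and finite additivity from
  the orbit measures, so they extend from clopen sets to a Borel probability measure.\<close>

lemma (in periodic_approximation) limit_measure_exists:
  obtains M where "periodic_limit_measure p l \<delta> M"
proof -
  have L: "(\<lambda>n. fr n C) \<longlonglongrightarrow> lim (\<lambda>n. fr n C)" if "C \<in> clopens" for C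
    using fr_convergent[OF that] by (simp add: convergent_LIMSEQ_iff)
  obtain M where M: "prob_space M" "sets M = sets borel"
    "\<And>C. C \<in> clopens \<Longrightarrow> measure M C = lim (\<lambda>n. fr n C)"
  proof (rule measure_extension_clopens)
    fix C assume C: "C \<in> clopens"
    show "0 \<le> lim (\<lambda>n. fr n C)"
      using L[OF C] by (rule LIMSEQ_le_const) (auto simp: freq_nonneg)
    fix D assume D: "D \<in> clopens" and disj: "C \<inter> D = {}"
    show "lim (\<lambda>n. fr n (C \<union> D)) = lim (\<lambda>n. fr n C) + lim (\<lambda>n. fr n D)"
      unfolding freq_Un[OF disj] by (intro limI tendsto_add L C D)
  next
    show "lim (\<lambda>n. fr n UNIV) = 1"
      by (simp add: freq_UNIV[OF l_pos])
  qed auto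
  then have "periodic_limit_measure p l \<delta> M"
    using L by (intro periodic_limit_measure.intro periodic_approximation_axioms
        periodic_limit_measure_axioms.intro) auto
  then show ?thesis by (rule that)
qed

section \<open>Invariance, ergodicity, nonatomicity and support of the limit measure\<close>

context periodic_limit_measure
begin

lemma space_M: "space M = UNIV"
  using sets_eq_imp_space_eq[OF sets_M] by simp

lemma clopens_sets: "C \<in> clopens \<Longrightarrow> C \<in> sets M"
  by (simp add: sets_M clopens_borel)

lemma shiftp_vimage_sets: "A \<in> sets M \<Longrightarrow> shiftp i -` A \<in> sets M"
  using measurable_sets[OF shiftp_measurable, of A i] by (simp add: sets_M)

lemma measure_close:
  assumes C: "C \<in> local_sets (int (l n))"
  shows "\<bar>measure M C - fr n C\<bar> \<le> \<delta> n"
proof (rule LIMSEQ_le_const2)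
  have "C \<in> clopens" using C by (auto simp: clopens_def)
  then show "(\<lambda>m. \<bar>fr m C - fr n C\<bar>) \<longlonglongrightarrow> \<bar>measure M C - fr n C\<bar>"
    by (intro tendsto_intros fr_lim)
  show "\<exists>N. \<forall>m\<ge>N. \<bar>fr m C - fr n C\<bar> \<le> \<delta> n"
    using fr_close C by blast
qed

lemma measure_unlike: "measure M (unlike (p n) (l n)) \<le> \<delta> n"
proof (rule LIMSEQ_le_const2)
  have "unlike (p n) (l n) \<in> clopens" using unlike_local by (auto simp: clopens_def)
  then show "(\<lambda>m. fr m (unlike (p n) (l n))) \<longlonglongrightarrow> measure M (unlike (p n) (l n))"
    by (rule fr_lim)
qed (use freq_unlike in blast)

text \<open>Frequencies along a periodic orbit do not change under the shift, so the two measures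
  agree on the clopen sets, an intersection-stable generator of the Borel sets.\<close>

lemma distr_shiftp: "distr M borel (shiftp i) = M"
proof (rule measure_eqI_generator_eq[OF Int_stable_clopens])
  fix C assume C: "C \<in> clopens"
  have m: "shiftp i \<in> M \<rightarrow>\<^sub>M borel"
    using shiftp_measurable by (simp add: measurable_cong_sets[OF sets_M refl])
  have "shiftp i -` C \<in> clopens"
    using C local_sets_shiftp by (fastforce simp: clopens_def)
  then have "(\<lambda>n. fr n C) \<longlonglongrightarrow> measure M (shiftp i -` C)"
    using fr_lim[of "shiftp i -` C"] by (simp add: freq_shiftp[OF period])
  then have "measure M (shiftp i -` C) = measure M C"
    using LIMSEQ_unique fr_lim[OF C] by blast
  then show "emeasure (distr M borel (shiftp i)) C = emeasure M C"
    using C by (simp add: emeasure_distr[OF m clopens_borel] space_M emeasure_eq_measure)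
next
  show "range (\<lambda>_::nat. UNIV) \<subseteq> clopens"
    by (auto simp: clopens_def local_sets_def)
  show "emeasure (distr M borel (shiftp i)) ((\<lambda>_::nat. UNIV) n) \<noteq> \<infinity>" for n
    using prob_space.prob_space_distr[of M "shiftp i" borel] finite_measure.emeasure_finite
      prob_space.finite_measure prob_space_axioms shiftp_measurable
    by (metis infinity_ennreal_def measurable_cong_sets sets_M)
qed (auto simp: sigma_sets_clopens sets_M)

lemma measure_shiftp_vimage:
  assumes "A \<in> sets M"
  shows "measure M (shiftp i -` A) = measure M A"
proof -
  have m: "shiftp i \<in> M \<rightarrow>\<^sub>M borel"
    using shiftp_measurable by (simp add: measurable_cong_sets[OF sets_M refl])
  have "measure (distr M borel (shiftp i)) A = measure M (shiftp i -` A)"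
    using assms by (simp add: measure_distr[OF m] sets_M space_M)
  then show ?thesis by (simp add: distr_shiftp)
qed

text \<open>By invariance the mass of \<open>A \<inter> C\<close> is the integral over
  \<open>A\<close> of the window average of \<open>C\<close>. That average equals the constant
  \<open>fr n C\<close> outside a set of mass at most \<open>\<delta> n\<close>; then let
  \<open>n\<close> tend to infinity.\<close>

lemma invariant_indep_clopen:
  assumes A: "A \<in> sets M" "shift -` A = A" and C: "C \<in> clopens"
  shows "measure M (A \<inter> C) = measure M A * measure M C"
proof -
  have inv: "shiftp (int j) -` A = A" for j
  proof (induction j)
    case (Suc j)
    have "shiftp (int (Suc j)) -` A = shiftp (int j) -` (shift -` A)"
      by (auto simp: add.commute)
    then show ?case using Suc A(2) by simp
  qed auto
  have *: "\<bar>measure M (A \<inter> C) - measure M A * fr n C\<bar> \<le> \<delta> n" if Cn: "C \<in> local_sets (int (l n))" for n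
  proof -
    define g where "g = (\<lambda>y. (\<Sum>j<l n. indicator C (shiftp (int j) y)) / real (l n))"
    have sets [measurable]: "shiftp (int j) -` C \<in> sets M" "C \<in> sets M" for j
      using clopens_sets[OF C] shiftp_vimage_sets by auto
    have A' [measurable]: "A \<in> sets M" by (rule A)
    have gm [measurable]: "g \<in> borel_measurable M"
    proof -
      have "(\<lambda>y. \<Sum>j<l n. indicator (shiftp (int j) -` C) y :: real) \<in> borel_measurable M"
        by measurable
      then show ?thesis by (simp add: g_def indicator_def)
    qed
    \<comment> \<open>Pulling back \<open>A \<inter> C\<close> by the shift moves only
      \<open>C\<close>, as \<open>A\<close> is invariant; so the mass can be averaged over one
      period.\<close>
    have "measure M (A \<inter> C) = measure M (A \<inter> shiftp (int j) -` C)" for j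
      using measure_shiftp_vimage[of "A \<inter> C" "int j"] inv[of j] by (simp add: vimage_Int)
    then have "measure M (A \<inter> C) = (\<Sum>j<l n. measure M (A \<inter> shiftp (int j) -` C)) / real (l n)"
      using l_pos[of n] by simp
    also have "\<dots> = (\<integral>y. (\<Sum>j<l n. indicator (A \<inter> shiftp (int j) -` C) y) / real (l n) \<partial>M)"
    proof -
      have "integrable M (indicat_real (A \<inter> shiftp (int j) -` C))" for j
        by (intro integrable_real_indicator) (auto simp: emeasure_eq_measure)
      then show ?thesis by (simp add: Bochner_Integration.integral_sum space_M)
    qed
    also have "\<dots> = (\<integral>y. indicator A y * g y \<partial>M)"
      by (rule Bochner_Integration.integral_cong)
        (auto simp: g_def indicator_inter_arith sum_distrib_left indicator_def)
    finally have 1: "measure M (A \<inter> C) = (\<integral>y. indicator A y * g y \<partial>M)" .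
    have close: "\<bar>g y - fr n C\<bar> \<le> indicator (unlike (p n) (l n)) y" for y
      unfolding g_def by (intro window_average period l_pos Cn)
    have un [measurable]: "unlike (p n) (l n) \<in> sets M"
      using unlike_local by (intro clopens_sets) (auto simp: clopens_def)
    have gb: "\<bar>g y\<bar> \<le> \<bar>fr n C\<bar> + 1" for y
    proof -
      have "indicator (unlike (p n) (l n)) y \<le> (1::real)" by (simp add: indicator_def)
      then show ?thesis using close[of y] by linarith
    qed
    have int1: "integrable M (\<lambda>y. indicator A y * g y)"
      by (rule integrable_const_bound[of _ "\<bar>fr n C\<bar> + 1"])
        (auto simp: abs_mult indicator_def gb)
    have int2: "integrable M (\<lambda>y. indicator A y * fr n C)"
      by (intro integrable_mult_left integrable_real_indicator) (auto simp: emeasure_eq_measure)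
    have close': "\<bar>indicator A y * g y - indicator A y * fr n C\<bar> \<le> indicator (unlike (p n) (l n)) y" for y
      using close[of y] by (cases "y \<in> A") auto
    have "measure M (A \<inter> C) - measure M A * fr n C = (\<integral>y. indicator A y * g y - indicator A y * fr n C \<partial>M)"
      using int1 int2 by (simp add: 1 space_M)
    also have "\<bar>\<dots>\<bar> \<le> (\<integral>y. \<bar>indicator A y * g y - indicator A y * fr n C\<bar> \<partial>M)"
      by (rule integral_abs_bound)
    also have "\<dots> \<le> (\<integral>y. indicator (unlike (p n) (l n)) y \<partial>M)"
    proof (rule integral_mono)
      show "integrable M (\<lambda>y. \<bar>indicator A y * g y - indicator A y * fr n C\<bar>)"
        by (intro integrable_abs Bochner_Integration.integrable_diff int1 int2)
      show "integrable M (indicat_real (unlike (p n) (l n)))"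
        by (intro integrable_real_indicator) (auto simp: emeasure_eq_measure)
    qed (rule close')
    also have "\<dots> = measure M (unlike (p n) (l n))" by (simp add: space_M)
    also have "\<dots> \<le> \<delta> n" by (rule measure_unlike)
    finally show ?thesis .
  qed
  have "(\<lambda>n. measure M A * fr n C - measure M (A \<inter> C)) \<longlonglongrightarrow> 0"
  proof (rule tendsto_0_le[OF \<delta>_lim, of _ 1])
    show "\<forall>\<^sub>F n in sequentially. norm (measure M A * fr n C - measure M (A \<inter> C)) \<le> norm (\<delta> n) * 1"
      using clopens_eventually_local[OF C] by eventually_elim (use * in fastforce)
  qed
  moreover have "(\<lambda>n. measure M A * fr n C - measure M (A \<inter> C)) \<longlonglongrightarrow> measure M A * measure M C - measure M (A \<inter> C)"
    by (intro tendsto_intros fr_lim C)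
  ultimately show ?thesis using LIMSEQ_unique by fastforce
qed

text \<open>The Borel sets independent of \<open>A\<close> form a Dynkin system containing the
  clopen sets, hence include \<open>A\<close> itself. So the mass of \<open>A\<close> equals its own
  square.\<close>

lemma ergodic:
  assumes A: "A \<in> sets M" "shift -` A = A"
  shows "measure M A = 0 \<or> measure M A = 1"
proof -
  have sM: "sigma_sets UNIV clopens = sets M" by (simp add: sigma_sets_clopens sets_M)
  have "measure M (A \<inter> A) = measure M A * measure M A"
  proof -
    have "clopens \<subseteq> Pow UNIV" by simp
    with Int_stable_clopens have "measure M (A \<inter> B) = measure M A * measure M B"
      if "B \<in> sigma_sets UNIV clopens" for B
      using that
    proof (induction rule: sigma_sets_induct_disjoint)
      case (basic C)
      then show ?case by (rule invariant_indep_clopen[OF A])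
    next
      case empty
      show ?case by simp
    next
      case (compl B)
      then have B: "B \<in> sets M" by (simp add: sM)
      have "A \<inter> (UNIV - B) = A - A \<inter> B" by auto
      moreover have "measure M (A - A \<inter> B) = measure M A - measure M (A \<inter> B)"
        using A(1) B by (intro finite_measure_Diff) auto
      moreover have "measure M (UNIV - B) = 1 - measure M B"
        using prob_compl[OF B] by (simp add: space_M)
      ultimately show ?case using compl.IH by (simp only: right_diff_distrib mult_1_right)
    next
      case (union B)
      then have B: "range B \<subseteq> sets M" by (simp add: sM)
      have "(\<lambda>i. measure M A * measure M (B i)) sums (measure M A * measure M (\<Union>i. B i))"
        by (intro sums_mult finite_measure_UNION B union)
      moreover have "(\<lambda>i. measure M (A \<inter> B i)) sums measure M (\<Union>i. A \<inter> B i)"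
        using B A(1) union by (intro finite_measure_UNION) (auto simp: disjoint_family_on_def)
      moreover have "measure M (A \<inter> B i) = measure M A * measure M (B i)" for i
        by (rule union.IH)
      ultimately have "measure M (\<Union>i. A \<inter> B i) = measure M A * measure M (\<Union>i. B i)"
        by (simp only: sums_iff)
      then show ?case by (simp only: Int_UN_distrib)
    qed
    from this[of A] show ?thesis using A(1) unfolding sM .
  qed
  then show ?thesis by simp
qed

text \<open>Some position of the \<open>n\<close>-th periodic point is moved by the translation by
  \<open>q\<close>. It contributes at least \<open>1 / real (l n)\<close> to the frequency, more
  than passing to the limit can destroy.\<close>

lemma displacement_positive:
  assumes "0 < q"
  shows "0 < measure M {x. x 0 \<noteq> x (int q)}"
proof -
  define C where "C = {x :: int \<Rightarrow> bool. x 0 \<noteq> x (int q)}"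
  obtain n j where n: "q \<le> n" "\<delta> n < 1 / real (l n)" "p n (j + int q) \<noteq> p n j"
    using aperiodic[OF assms] by blast
  have C: "C \<in> local_sets (int (l n))"
    using n(1) l_gt[of n] by (auto simp: C_def local_sets_def agree_def)
  have "1 / real (l n) \<le> fr n C"
  proof -
    \<comment> \<open>Translating by \<open>j\<close> brings the moved position to index 0 of the
      sum, so that this single term gives the lower bound.\<close>
    have "fr n C = freq (p n) (l n) (shiftp j -` C)"
      by (simp add: freq_shiftp[OF period])
    also have "\<dots> = (\<Sum>i<l n. indicator C (shiftp (j + int i) (p n))) / real (l n)"
      by (simp add: freq_def indicator_def)
    also have "\<dots> \<ge> (\<Sum>i\<in>{0}. indicator C (shiftp (j + int i) (p n))) / real (l n)"
      using l_pos[of n] by (intro divide_right_mono sum_mono2) auto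
    also have "(\<Sum>i\<in>{0}. indicator C (shiftp (j + int i) (p n))) = (1::real)"
      using n(3) by (simp add: C_def shiftp_def add.commute)
    finally show ?thesis .
  qed
  then show ?thesis using measure_close[OF C] n(2) unfolding C_def by linarith
qed

text \<open>All points in the orbit of an atom have equal mass, so the orbit is finite and the atom
  has some period \<open>q\<close>. The invariant set of points with period \<open>q\<close> then
  has positive mass, hence full mass by ergodicity, against
  \<open>displacement_positive\<close>.\<close>

lemma measure_singleton: "measure M {x} = 0"
proof (rule ccontr)
  assume pos: "measure M {x} \<noteq> 0"
  have cl: "{y} \<in> sets M" for y
    by (simp add: sets_M closed_finite_full_shift)
  have eq: "measure M {shiftp (int j) x} = measure M {x}" for j
  proof -
    have "shiftp (int j) -` {shiftp (int j) x} = {x}"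
    proof -
      have "y = x" if "shiftp (int j) y = shiftp (int j) x" for y
        using arg_cong[OF that, of "shiftp (- int j)"] by simp
      then show ?thesis by auto
    qed
    then show ?thesis using measure_shiftp_vimage[OF cl, of "int j" "shiftp (int j) x"] by simp
  qed
  have "\<not> inj (\<lambda>j::nat. shiftp (int j) x)"
  proof
    assume inj: "inj (\<lambda>j::nat. shiftp (int j) x)"
    have "(\<lambda>j. measure M {shiftp (int j) x}) sums measure M (\<Union>j. {shiftp (int j) x})"
      using inj cl by (intro finite_measure_UNION) (auto simp: disjoint_family_on_def inj_def)
    then have "summable (\<lambda>j::nat. measure M {x})"
      by (simp add: eq sums_iff)
    then show False using pos by (simp add: summable_const_iff)
  qed
  then obtain i j :: nat where ij: "shiftp (int i) x = shiftp (int j) x" "i < j"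
    by (auto simp: inj_def) (metis linorder_neqE_nat)
  define q where "q = j - i"
  have q: "0 < q" "shiftp (int q) x = x"
  proof -
    show "0 < q" using ij(2) by (simp add: q_def)
    show "shiftp (int q) x = x"
      using arg_cong[OF ij(1), of "shiftp (- int i)"] ij(2) by (simp add: q_def of_nat_diff)
  qed
  define D where "D = {y :: int \<Rightarrow> bool. shiftp (int q) y = y}"
  \<comment> \<open>Measurability: a point fails to have period \<open>q\<close> exactly when one of
    its countably many shifts lies in a fixed clopen set.\<close>
  have D: "D = - (\<Union>k. shiftp k -` {y. y 0 \<noteq> y (int q)})"
    by (auto simp: D_def shiftp_def fun_eq_iff add.commute)
  have E: "{y. y 0 \<noteq> y (int q)} \<in> sets M"
    by (intro clopens_sets) (auto simp: clopens_def local_sets_def agree_def intro!: exI[of _ "int q"])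
  have DM: "D \<in> sets M"
    unfolding D using shiftp_vimage_sets[OF E] sets.compl_sets[of _ M]
    by (simp add: space_M Compl_eq_Diff_UNIV sets.countable_UN')
  have "shift -` D = D"
  proof -
    have "shiftp (int q) (shiftp 1 y) = shiftp 1 y \<longleftrightarrow> shiftp (int q) y = y" for y
    proof
      assume "shiftp (int q) (shiftp 1 y) = shiftp 1 y"
      from arg_cong[OF this, of "shiftp (-1)"] show "shiftp (int q) y = y" by simp
    next
      assume "shiftp (int q) y = y"
      from arg_cong[OF this, of "shiftp 1"] show "shiftp (int q) (shiftp 1 y) = shiftp 1 y"
        by (simp add: add.commute)
    qed
    then show ?thesis by (auto simp: D_def)
  qed
  moreover have "measure M D \<noteq> 0"
  proof -
    have "measure M {x} \<le> measure M D"
      using q(2) DM by (intro finite_measure_mono) (auto simp: D_def)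
    then show ?thesis using pos measure_nonneg[of M "{x}"] by linarith
  qed
  ultimately have "measure M D = 1" using ergodic[OF DM] by blast
  then have "measure M (UNIV - D) = 0" using prob_compl[OF DM] by (simp add: space_M)
  moreover have "measure M {y. y 0 \<noteq> y (int q)} \<le> measure M (UNIV - D)"
    using DM sets.compl_sets[OF DM]
    by (intro finite_measure_mono) (auto simp: D_def shiftp_def space_M dest: fun_cong[where x = 0])
  ultimately show False using displacement_positive[OF q(1)] by simp
qed

text \<open>The complement of \<open>S\<close> is a countable union of clopen sets. The periodic
  orbits never enter these, so their frequencies, and hence their masses, vanish.\<close>

lemma measure_closed_support:
  assumes S: "closed S" "\<And>n j. shiftp j (p n) \<in> S"
  shows "measure M S = 1"
proof -
  obtain F where F: "countable F" "F \<subseteq> clopens" "\<Union>F = - S"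
    using open_countable_Union_clopens[of "- S"] S(1) by auto
  have "C \<in> null_sets M" if "C \<in> F" for C
  proof -
    have C: "C \<in> clopens" using that F by blast
    have "shiftp j (p n) \<notin> C" for j n using S(2)[of j n] F(3) that by blast
    then have "fr n C = 0" for n by (simp add: freq_def)
    then have "(\<lambda>n. fr n C) \<longlonglongrightarrow> 0" by simp
    then have "measure M C = 0" by (rule LIMSEQ_unique[OF fr_lim[OF C]])
    then show ?thesis using C by (simp add: null_sets_def clopens_sets emeasure_eq_measure)
  qed
  then have "- S \<in> null_sets M"
    using null_sets_UN'[OF F(1), of "\<lambda>C. C" M] F(3) by simp
  then have "measure M (UNIV - S) = 0"
    by (simp add: null_sets_def measure_def Compl_eq_Diff_UNIV)
  moreover have "S \<in> sets M" using S(1) by (simp add: sets_M)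
  ultimately show ?thesis using prob_compl[of S] by (simp add: space_M)
qed

lemma ergodic_nonatomic_restrict:
  assumes S: "closed S" "\<And>n j. shiftp j (p n) \<in> S" and inv: "shift -` S = S"
  shows "ergodic_nonatomic_on S (restrict_space M S)"
proof -
  have SM [measurable]: "S \<in> sets M" using S(1) by (simp add: sets_M)
  have one: "measure M S = 1" by (rule measure_closed_support[OF S])
  have sp: "space (restrict_space M S) = S" by (simp add: space_restrict_space space_M)
  have sets: "A \<in> sets (restrict_space M S) \<longleftrightarrow> A \<subseteq> S \<and> A \<in> sets M" for A
    using sets_restrict_space_iff[of S M A] SM by (simp add: space_M)
  have em: "emeasure (restrict_space M S) A = ennreal (measure M A)" if "A \<subseteq> S" for A
    using that SM by (simp add: emeasure_restrict_space space_M emeasure_eq_measure)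
  have Sc: "measure M (shiftp i -` A \<inter> S) = measure M A" if "A \<in> sets M" for A i
  proof -
    have "measure M (shiftp i -` A \<inter> S) = measure M (shiftp i -` A)"
    proof (rule measure_eq_AE)
      show "AE x in M. x \<in> shiftp i -` A \<inter> S \<longleftrightarrow> x \<in> shiftp i -` A"
        using AE_in_set_eq_1[OF SM] one by auto
    qed (use that shiftp_vimage_sets in auto)
    then show ?thesis by (simp add: measure_shiftp_vimage that)
  qed
  show ?thesis
    unfolding ergodic_nonatomic_on_def
  proof (intro conjI)
    have "prob_space (restrict_space M S)"
      using em[of S] one by (intro prob_spaceI) (simp add: sp)
    moreover have "Sigma_Algebra.sets (restrict_space M S) = Sigma_Algebra.sets (restrict_space borel S)"
      by (simp add: sets_restrict_space sets_M)
    ultimately show "borel_prob_on S (restrict_space M S)" by (simp add: borel_prob_on_def)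
    show "shift_invariant (restrict_space M S)"
      unfolding shift_invariant_def sp
      using shiftp_vimage_sets SM by (auto simp: sets em Sc)
    show "nonatomic (restrict_space M S)"
      by (auto simp: nonatomic_def sp em measure_singleton)
    show "shift_ergodic (restrict_space M S)"
      unfolding shift_ergodic_def sp
    proof (intro ballI impI)
      fix A assume A: "A \<in> Sigma_Algebra.sets (restrict_space M S)" "shift -` A \<inter> S = A"
      then have AM: "A \<in> Sigma_Algebra.sets M" "A \<subseteq> S" by (auto simp: sets)
      \<comment> \<open>Invariance relative to \<open>S\<close> is invariance in the full shift,
        because the preimage of \<open>A\<close> stays inside the invariant set
        \<open>S\<close>.\<close>
      have "shift -` A = A" using A(2) AM(2) inv by auto
      then show "emeasure (restrict_space M S) A = 0 \<or> emeasure (restrict_space M S) A = 1"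
        using ergodic[OF AM(1)] em[OF AM(2)] by auto
    qed
  qed
qed

end

section \<open>The block construction\<close>

primrec list_power :: "nat \<Rightarrow> 'a list \<Rightarrow> 'a list" where
  "list_power 0 u = []"
| list_power_Suc: "list_power (Suc k) u = list_power k u @ u"

declare list_power_Suc [simp del]

lemma length_list_power [simp]: "length (list_power k u) = k * length u"
  by (induction k) (simp_all add: list_power_Suc)

definition per :: "bool list \<Rightarrow> int \<Rightarrow> bool" where
  "per u k = u ! nat (k mod int (length u))"

lemma per_add_mult [simp]: "per u (k + int (length u) * a) = per u k"
  by (simp add: per_def)

lemma shiftp_per: "shiftp (int (length u)) (per u) = per u"
  using per_add_mult[of u _ 1] by (simp add: shiftp_def)

definition occurs :: "(int \<Rightarrow> bool) \<Rightarrow> int \<Rightarrow> bool list \<Rightarrow> bool" where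
  "occurs x t u \<longleftrightarrow> (\<forall>k<length u. x (t + int k) = u ! k)"

lemma occurs_append: "occurs x t (u @ v) \<longleftrightarrow> occurs x t u \<and> occurs x (t + int (length u)) v"
proof
  assume *: "occurs x t (u @ v)"
  have "occurs x t u"
    unfolding occurs_def
  proof (intro allI impI)
    fix k assume "k < length u"
    then show "x (t + int k) = u ! k"
      using *[unfolded occurs_def, rule_format, of k] by (simp add: nth_append)
  qed
  moreover have "occurs x (t + int (length u)) v"
    unfolding occurs_def
  proof (intro allI impI)
    fix k assume "k < length v"
    then show "x (t + int (length u) + int k) = v ! k"
      using *[unfolded occurs_def, rule_format, of "length u + k"] by (simp add: add.assoc)
  qed
  ultimately show "occurs x t u \<and> occurs x (t + int (length u)) v" by blast
next
  assume *: "occurs x t u \<and> occurs x (t + int (length u)) v"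
  show "occurs x t (u @ v)"
    unfolding occurs_def
  proof (intro allI impI)
    fix k assume k: "k < length (u @ v)"
    show "x (t + int k) = (u @ v) ! k"
    proof (cases "k < length u")
      case True
      then show ?thesis using * by (simp add: occurs_def nth_append)
    next
      case False
      then have "k - length u < length v" using k by simp
      then have "x (t + int (length u) + int (k - length u)) = v ! (k - length u)"
        using * unfolding occurs_def by blast
      moreover have "t + int (length u) + int (k - length u) = t + int k"
        using False by simp
      ultimately show ?thesis using False by (simp only: nth_append if_False)
    qed
  qed
qed

lemma occurs_list_power_nth: "occurs x t (list_power k u) \<Longrightarrow> i < k \<Longrightarrow> occurs x (t + int (i * length u)) u"
  by (induction k) (auto simp: list_power_Suc occurs_append less_Suc_eq)

lemma occurs_list_power_per:
  assumes "occurs x t (list_power k u)" "0 \<le> j" "j < int (k * length u)"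
  shows "x (t + j) = per u j"
proof -
  define L where "L = int (length u)"
  have L: "0 < L" using assms by (cases "length u = 0") (auto simp: L_def)
  have "j div L < int k"
  proof (rule ccontr)
    assume "\<not> j div L < int k"
    then have "L * int k \<le> L * (j div L)" using L by simp
    also have "\<dots> \<le> j"
      using L pos_mod_sign[OF L, of j] mult_div_mod_eq[of L j] by linarith
    finally show False using assms(3) by (simp add: L_def mult.commute)
  qed
  then have "nat (j div L) < k" using L assms(2) by (simp add: nat_less_iff pos_imp_zdiv_nonneg_iff)
  from occurs_list_power_nth[OF assms(1) this] have "occurs x (t + int (nat (j div L) * length u)) u" .
  moreover have "nat (j mod L) < length u" using L pos_mod_bound[OF L, of j] pos_mod_sign[OF L, of j] unfolding L_def by linarith
  ultimately have "x (t + int (nat (j div L) * length u) + int (nat (j mod L))) = u ! nat (j mod L)"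
    unfolding occurs_def by blast
  moreover have "t + int (nat (j div L) * length u) + int (nat (j mod L)) = t + j"
  proof -
    have "int (nat (j div L) * length u) = (j div L) * L"
      using L assms(2) by (simp add: L_def pos_imp_zdiv_nonneg_iff)
    then show ?thesis using L by (simp add: add.assoc)
  qed
  ultimately show ?thesis by (simp only: per_def L_def)
qed

lemma occurs_per: "occurs (per u) (int (length u) * a) u"
  by (auto simp: occurs_def per_def nat_mod_as_int)

text \<open>The spacer is written out inside the recursion because it refers to all earlier words;
  \<open>block_Suc\<close> restates the recursion with \<open>spacer\<close> and
  \<open>repetitions\<close>. The exponent \<open>Suc n\<close> in the spacer grows with the level,
  so each earlier periodic orbit reappears on longer and longer stretches.\<close>

fun block :: "nat \<Rightarrow> bool \<Rightarrow> bool list" where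
  "block 0 c = [c]"
| "block (Suc n) c =
    (let s = concat (map (\<lambda>i. list_power (Suc n) (block i True) @ block n True @ list_power (Suc n) (block i False) @ block n True) [0..<Suc n])
     in list_power (4 ^ Suc n * (4 * length (block n c) + length s)) (block n c) @ s)"

definition spacer :: "nat \<Rightarrow> bool list" where
  "spacer n = concat (map (\<lambda>i. list_power (Suc n) (block i True) @ block n True @ list_power (Suc n) (block i False) @ block n True) [0..<Suc n])"

definition block_len :: "nat \<Rightarrow> nat" where
  "block_len n = length (block n True)"

text \<open>The factor \<open>4 ^ Suc n\<close> beats the number of positions in a word of level \<open>Suc n\<close> that are
  near the ends of the power or in the spacer; the resulting errors are summable, with a tail below
  the frequency \<open>1 / block_len n\<close> of a single position.\<close>

definition repetitions :: "nat \<Rightarrow> nat" where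
  "repetitions n = 4 ^ Suc n * (4 * block_len n + length (spacer n))"

declare block.simps(2) [simp del]

lemma length_block [simp]: "length (block n c) = block_len n"
proof (induction n arbitrary: c)
  case (Suc n)
  show ?case unfolding block_len_def block.simps(2) by (simp add: Suc Let_def)
qed (simp add: block_len_def)

lemma block_Suc: "block (Suc n) c = list_power (repetitions n) (block n c) @ spacer n"
  unfolding block.simps(2) Let_def repetitions_def spacer_def by simp

lemma block_len_0 [simp]: "block_len 0 = 1"
  by (simp add: block_len_def)

lemma block_len_Suc: "block_len (Suc n) = repetitions n * block_len n + length (spacer n)"
  by (metis length_append length_list_power length_block block_Suc)

lemma block_len_pos: "0 < block_len n"
proof (induction n)
  case (Suc n)
  then show ?case by (simp add: block_len_Suc repetitions_def)
qed simp

lemma repetitions_ge: "4 \<le> repetitions n"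
proof -
  have "1 * 4 \<le> (4::nat) ^ Suc n * (4 * block_len n + length (spacer n))"
    using block_len_pos[of n] by (intro mult_mono) auto
  then show ?thesis by (simp add: repetitions_def)
qed

lemma block_len_less_Suc: "block_len n < block_len (Suc n)"
proof -
  have "4 * block_len n \<le> repetitions n * block_len n" by (rule mult_right_mono[OF repetitions_ge]) simp
  then show ?thesis using block_len_pos[of n] unfolding block_len_Suc by linarith
qed

lemma block_len_mono: "m \<le> n \<Longrightarrow> block_len m \<le> block_len n"
  by (rule lift_Suc_mono_le[of block_len]) (simp_all add: less_imp_le block_len_less_Suc)

lemma less_block_len: "n < block_len n"
proof (induction n)
  case (Suc n)
  then show ?case using block_len_less_Suc[of n] by linarith
qed simp

section \<open>Decomposition of a point into words of a fixed level and periodic stretches\<close>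

definition level :: "nat \<Rightarrow> (int \<Rightarrow> bool) \<Rightarrow> int \<Rightarrow> bool" where
  "level r x t \<longleftrightarrow> (\<exists>c. occurs x t (block r c))"

text \<open>The flanking words in the second alternative are essential: in a window free of words of
  level \<open>r\<close>, they force the periodic stretch to run past both ends of the
  window.\<close>

definition covered :: "nat \<Rightarrow> (int \<Rightarrow> bool) \<Rightarrow> int \<Rightarrow> bool" where
  "covered r x j \<longleftrightarrow>
     (\<exists>s. level r x s \<and> s \<le> j \<and> j < s + int (block_len r)) \<or>
     (\<exists>s e i d a. i < r \<and> s \<le> j \<and> j < e \<and> level r x (s - int (block_len r)) \<and> level r x e \<and>
        (\<forall>k. s \<le> k \<and> k < e \<longrightarrow> x k = per (block i d) (k + a)))"

text \<open>Demanding a word of level \<open>r\<close> at both ends makes the property stable under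
  concatenation and supplies the flanks when a periodic stretch is inserted between two such
  words.\<close>

definition well_covered :: "nat \<Rightarrow> bool list \<Rightarrow> bool" where
  "well_covered r u \<longleftrightarrow> (\<forall>x t. occurs x t u \<longrightarrow>
     level r x t \<and> level r x (t + int (length u) - int (block_len r)) \<and>
     (\<forall>j. t \<le> j \<and> j < t + int (length u) \<longrightarrow> covered r x j))"

lemma well_coveredD:
  assumes "well_covered r u" "occurs x t u"
  shows "level r x t" "level r x (t + int (length u) - int (block_len r))"
    "t \<le> j \<Longrightarrow> j < t + int (length u) \<Longrightarrow> covered r x j"
  using assms by (auto simp: well_covered_def)

lemma well_covered_append:
  assumes "well_covered r u" "well_covered r v"
  shows "well_covered r (u @ v)"
  unfolding well_covered_def
proof (intro allI impI, intro conjI allI impI)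
  fix x t assume "occurs x t (u @ v)"
  then have o: "occurs x t u" "occurs x (t + int (length u)) v" by (auto simp: occurs_append)
  note U = well_coveredD[OF assms(1) o(1)] and V = well_coveredD[OF assms(2) o(2)]
  show "level r x t" by (rule U)
  show "level r x (t + int (length (u @ v)) - int (block_len r))"
    using V(2) by (simp add: add.assoc)
  show "covered r x j" if "t \<le> j \<and> j < t + int (length (u @ v))" for j
    using U(3)[of j] V(3)[of j] that by (cases "j < t + int (length u)") auto
qed

lemma well_covered_insert:
  assumes "well_covered r u" "well_covered r v" "i < r"
  shows "well_covered r (u @ list_power k (block i d) @ v)"
  unfolding well_covered_def
proof (intro allI impI, intro conjI allI impI)
  fix x t assume *: "occurs x t (u @ list_power k (block i d) @ v)"
  define s e where "s = t + int (length u)" and "e = s + int (k * block_len i)"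
  have o: "occurs x t u" "occurs x s (list_power k (block i d))" "occurs x e v"
    using * by (auto simp: occurs_append s_def e_def)
  note U = well_coveredD[OF assms(1) o(1)] and V = well_coveredD[OF assms(2) o(3)]
  show "level r x t" by (rule U)
  show "level r x (t + int (length (u @ list_power k (block i d) @ v)) - int (block_len r))"
    using V(2) by (simp add: s_def e_def add.assoc)
  show "covered r x j" if j: "t \<le> j \<and> j < t + int (length (u @ list_power k (block i d) @ v))" for j
  proof -
    consider "j < s" | "s \<le> j" "j < e" | "e \<le> j" by linarith
    then show ?thesis
    proof cases
      case 1
      then show ?thesis using U(3)[of j] j by (simp add: s_def)
    next
      case 3
      then show ?thesis using V(3)[of j] j by (simp add: s_def e_def)
    next
      case 2
      \<comment> \<open>The phase is \<open>- s\<close> because the power starts at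
        \<open>s\<close>.\<close>
      have "x m = per (block i d) (m + - s)" if "s \<le> m \<and> m < e" for m
        using occurs_list_power_per[OF o(2), of "m - s"] that by (simp add: e_def)
      moreover have "level r x (s - int (block_len r))" using U(2) by (simp add: s_def)
      ultimately show ?thesis
        unfolding covered_def using 2 V(1) assms(3) by blast
    qed
  qed
qed

text \<open>The exponent is positive because the empty word in general has no words of level
  \<open>r\<close> at its ends.\<close>

lemma well_covered_list_power: "well_covered r u \<Longrightarrow> well_covered r (list_power (Suc k) u)"
  by (induction k) (simp_all only: list_power.simps append_Nil well_covered_append)

text \<open>Induction on the level: each power in the spacer is followed by a word of level
  \<open>m\<close>, so powers of words below level \<open>r\<close> always sit between well covered
  words, while all other factors are well covered by induction.\<close>

lemma well_covered_block: "r \<le> n \<Longrightarrow> well_covered r (block n c)"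
proof (induction n arbitrary: c rule: less_induct)
  case (less n)
  show ?case
  proof (cases "n = r")
    case True
    then show ?thesis
      by (auto simp: well_covered_def level_def covered_def)
  next
    case False
    with less.prems obtain m where m: "n = Suc m" "r \<le> m"
      by (metis Suc_le_D Suc_le_mono le_antisym not_less_eq_eq)
    have IH: "well_covered r (block i d)" if "r \<le> i" "i \<le> m" for i d
      using less.IH[of i d] that m by simp
    have step: "well_covered r (u @ list_power (Suc m) (block i d) @ block m True)" if "well_covered r u" "i \<le> m" for u i d
    proof (cases "i < r")
      case True
      then show ?thesis using that IH m by (intro well_covered_insert) auto
    next
      case False
      then show ?thesis using that IH m by (intro well_covered_append well_covered_list_power) auto
    qed
    \<comment> \<open>The accumulated prefix \<open>u\<close> stays arbitrary so that every newly
      inserted power has a well covered word on its left.\<close>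
    have blocks: "well_covered r (u @ concat (map (\<lambda>i. list_power (Suc m) (block i True) @ block m True @ list_power (Suc m) (block i False) @ block m True) is))"
      if "well_covered r u" "set is \<subseteq> {..m}" for u "is"
      using that
    proof (induction "is" arbitrary: u)
      case (Cons i "is")
      have "well_covered r ((u @ list_power (Suc m) (block i True) @ block m True) @ list_power (Suc m) (block i False) @ block m True)"
        using Cons.prems by (intro step) auto
      from Cons.IH[OF this] Cons.prems show ?case by simp
    qed simp
    have "well_covered r (list_power (repetitions m) (block m c))"
      using well_covered_list_power[OF IH[OF m(2)], of "repetitions m - 1" c] repetitions_ge[of m] by simp
    moreover have "set [0..<Suc m] \<subseteq> {..m}" by auto
    ultimately have "well_covered r (list_power (repetitions m) (block m c) @ spacer m)"
      unfolding spacer_def by (rule blocks)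
    then show ?thesis by (simp add: block_Suc m)
  qed
qed

section \<open>Words of high level show every window of the earlier periodic points\<close>

lemma spacer_contains:
  assumes "i \<le> n"
  obtains a b where "spacer n = a @ list_power (Suc n) (block i d) @ b"
proof -
  have "i \<in> set [0..<Suc n]" using assms by auto
  then obtain as bs where "[0..<Suc n] = as @ i # bs" by (meson split_list)
  then obtain a b where *: "spacer n =
      a @ list_power (Suc n) (block i True) @ block n True @ list_power (Suc n) (block i False) @ block n True @ b"
    unfolding spacer_def by (simp del: upt_Suc)
  show ?thesis
  proof (cases d)
    case True
    then show ?thesis using that[of a] * by simp
  next
    case False
    then show ?thesis using that[of "a @ list_power (Suc n) (block i True) @ block n True"] * by simp
  qed
qed

lemma occurs_block_Suc_list_power:
  assumes "occurs x t (block (Suc n) c)" "i \<le> n"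
  obtains t' where "occurs x t' (list_power (Suc n) (block i d))"
proof -
  obtain a b where "spacer n = a @ list_power (Suc n) (block i d) @ b"
    by (rule spacer_contains[OF assms(2)])
  with assms(1) that show ?thesis by (auto simp: block_Suc occurs_append)
qed

abbreviation periodic_block :: "bool \<Rightarrow> nat \<Rightarrow> int \<Rightarrow> bool" where
  "periodic_block c n \<equiv> per (block n c)"

lemma periodic_block_add_mult: "periodic_block c n (k + int (block_len n) * a) = periodic_block c n k"
  using per_add_mult[of "block n c"] by simp

text \<open>The power in the spacer eventually becomes longer than the window. The threshold depends
  on the window only, not on the point \<open>x\<close> containing the word; this uniformity serves
  both transitivity and the finiteness of proper closed invariant sets.\<close>

lemma visits:
  obtains n0 where "\<And>n c x t. n0 \<le> n \<Longrightarrow> occurs x t (block (Suc n) c) \<Longrightarrow>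
    \<exists>t'. agree k (shiftp t' x) (shiftp j (periodic_block d i))"
proof -
  \<comment> \<open>A position congruent to \<open>j\<close> modulo the period, far enough to the
    right that the window of radius \<open>k\<close> around it starts inside the power.\<close>
  define j' where "j' = j + int (block_len i) * (\<bar>j\<bar> + \<bar>k\<bar>)"
  have "1 * (\<bar>j\<bar> + \<bar>k\<bar>) \<le> int (block_len i) * (\<bar>j\<bar> + \<bar>k\<bar>)"
    using block_len_pos[of i] by (intro mult_right_mono) auto
  then have "\<bar>j\<bar> + \<bar>k\<bar> \<le> j' - j" by (simp add: j'_def)
  then have j': "k \<le> j'" "0 \<le> j'" by linarith+
  show ?thesis
  proof (rule that[of "max i (nat (j' + \<bar>k\<bar>))"])
    fix n c x t
    assume n: "max i (nat (j' + \<bar>k\<bar>)) \<le> n" and "occurs x t (block (Suc n) c)"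
    then obtain t' where t': "occurs x t' (list_power (Suc n) (block i d))"
      using occurs_block_Suc_list_power[of x t n c i d] by auto
    have "Suc n * 1 \<le> Suc n * block_len i"
      using block_len_pos[of i] by (intro mult_left_mono) auto
    then have "int (Suc n) \<le> int (Suc n * block_len i)" unfolding of_nat_le_iff mult_1_right .
    moreover have "j' + \<bar>k\<bar> < int (Suc n)" using n by linarith
    ultimately have big: "j' + \<bar>k\<bar> < int (Suc n * block_len i)" by (rule order_less_le_trans[rotated])
    have "x (m + (t' + j')) = periodic_block d i (m + j)" if "\<bar>m\<bar> \<le> k" for m
    proof -
      have "x (t' + (m + j')) = periodic_block d i (m + j')"
        using that j' big by (intro occurs_list_power_per[OF t']) auto
      also have "\<dots> = periodic_block d i (m + j)"
        using periodic_block_add_mult[of i d "m + j"] by (simp add: j'_def add.assoc)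
      finally show ?thesis by (simp add: algebra_simps)
    qed
    then have "agree k (shiftp (t' + j') x) (shiftp j (periodic_block d i))"
      by (simp add: agree_def shiftp_def)
    then show "\<exists>t'. agree k (shiftp t' x) (shiftp j (periodic_block d i))" by blast
  qed
qed

lemma occurs_periodic_block: "occurs (periodic_block c n) 0 (block n c)"
  using occurs_per[of "block n c" 0] by simp

lemma periodic_block_covered:
  assumes "r \<le> m"
  shows "covered r (periodic_block c m) j"
proof -
  define L where "L = int (block_len m)"
  have "occurs (periodic_block c m) (L * (j div L)) (block m c)"
    using occurs_per[of "block m c"] by (simp add: L_def)
  moreover have "L * (j div L) \<le> j" "j < L * (j div L) + L"
  proof -
    have "0 \<le> j mod L" "j mod L < L" "L * (j div L) + j mod L = j"
      using block_len_pos[of m] by (auto simp: L_def)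
    then show "L * (j div L) \<le> j" "j < L * (j div L) + L" by linarith+
  qed
  ultimately show ?thesis
    using well_coveredD(3)[OF well_covered_block[OF assms]] by (simp add: L_def)
qed

lemma shiftp_periodic_block: "shiftp (int (block_len n)) (periodic_block c n) = periodic_block c n"
  using shiftp_per[of "block n c"] by simp

lemma finite_orbit_periodic_block: "finite (orbit (periodic_block c n))"
proof -
  have "shiftp j (periodic_block c n) \<in> (\<lambda>i. shiftp i (periodic_block c n)) ` {0..<int (block_len n)}" for j
  proof
    have "j = j mod int (block_len n) + int (block_len n) * (j div int (block_len n))" by simp
    then show "shiftp j (periodic_block c n) = shiftp (j mod int (block_len n)) (periodic_block c n)"
      unfolding shiftp_def by (metis add.assoc periodic_block_add_mult)
    show "j mod int (block_len n) \<in> {0..<int (block_len n)}" using block_len_pos[of n] by simp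
  qed
  then show ?thesis
    unfolding orbit_def by (meson finite_atLeastLessThan_int finite_imageI finite_subset image_subsetI)
qed

section \<open>The subshift\<close>

definition cam_shift :: "(int \<Rightarrow> bool) set" where
  "cam_shift = closure (\<Union>c n. orbit (periodic_block c n))"

lemma cam_shift_iff: "x \<in> cam_shift \<longleftrightarrow> (\<forall>k. \<exists>c n j. agree k x (shiftp j (periodic_block c n)))"
  by (auto simp: cam_shift_def closure_iff_agree orbit_def)

lemma shiftp_cam_shift: "x \<in> cam_shift \<Longrightarrow> shiftp j x \<in> cam_shift"
  unfolding cam_shift_iff
proof
  fix k assume "\<forall>k. \<exists>c n i. agree k x (shiftp i (periodic_block c n))"
  then obtain c n i where "agree (k + \<bar>j\<bar>) x (shiftp i (periodic_block c n))" by blast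
  from agree_shiftp[OF this, of k j] show "\<exists>c n i. agree k (shiftp j x) (shiftp i (periodic_block c n))"
    by auto
qed

lemma shiftp_cam_shift_iff: "shiftp j x \<in> cam_shift \<longleftrightarrow> x \<in> cam_shift"
  using shiftp_cam_shift[of "shiftp j x" "- j"] shiftp_cam_shift by auto

lemma periodic_block_cam_shift: "shiftp j (periodic_block c n) \<in> cam_shift"
  unfolding cam_shift_iff by (metis agree_refl)

lemma closed_cam_shift: "closed cam_shift"
  by (simp add: cam_shift_def)

lemma subshift_cam_shift: "subshift cam_shift"
proof -
  have "x \<in> shift ` cam_shift" if "x \<in> cam_shift" for x
    using that shiftp_cam_shift[of x "-1"] by (intro image_eqI[of _ _ "shiftp (-1) x"]) auto
  then show ?thesis using closed_cam_shift shiftp_cam_shift by (auto simp: subshift_def)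
qed

lemma top_transitive_cam_shift: "top_transitive cam_shift"
  unfolding top_transitive_def
proof (intro allI impI)
  fix U V
  assume H: "openin (top_of_set cam_shift) U \<and> openin (top_of_set cam_shift) V \<and> U \<noteq> {} \<and> V \<noteq> {}"
  \<comment> \<open>Every nonempty relatively open set is visited by all periodic orbits of
    sufficiently high level, so any two such sets meet one common orbit.\<close>
  have *: "\<exists>n0. \<forall>n\<ge>n0. \<exists>t. shiftp t (periodic_block True (Suc n)) \<in> W"
    if W: "openin (top_of_set cam_shift) W" "W \<noteq> {}" for W
  proof -
    obtain O' where O: "open O'" "W = cam_shift \<inter> O'" using W(1) by (auto simp: openin_open)
    obtain z where z: "z \<in> W" using W(2) by blast
    then obtain k where k: "\<And>y. agree k z y \<Longrightarrow> y \<in> O'"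
      using O by (auto simp: open_iff_agree)
    obtain d i j where zp: "agree k z (shiftp j (periodic_block d i))" using z O(2) cam_shift_iff by blast
    obtain n0 where n0: "\<And>n c x t. n0 \<le> n \<Longrightarrow> occurs x t (block (Suc n) c) \<Longrightarrow>
        \<exists>t'. agree k (shiftp t' x) (shiftp j (periodic_block d i))"
      using visits[of k j i d] by blast
    have "\<exists>t. shiftp t (periodic_block True (Suc n)) \<in> W" if n: "n0 \<le> n" for n
    proof -
      obtain t where "agree k (shiftp t (periodic_block True (Suc n))) (shiftp j (periodic_block d i))"
        using n0[OF n occurs_periodic_block] by blast
      then have "shiftp t (periodic_block True (Suc n)) \<in> O'"
        using k agree_trans[OF zp] agree_sym by blast
      then show ?thesis using O(2) periodic_block_cam_shift by blast
    qed
    then show ?thesis by blast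
  qed
  obtain a b where ab: "\<And>n. a \<le> n \<Longrightarrow> \<exists>t. shiftp t (periodic_block True (Suc n)) \<in> U"
    "\<And>n. b \<le> n \<Longrightarrow> \<exists>t. shiftp t (periodic_block True (Suc n)) \<in> V"
    using *[of U] *[of V] H by blast
  obtain s t where "shiftp s (periodic_block True (Suc (max a b))) \<in> U" "shiftp t (periodic_block True (Suc (max a b))) \<in> V"
    using ab[of "max a b"] by auto
  moreover have "shiftp (t - s) (shiftp s (periodic_block True (Suc (max a b)))) = shiftp t (periodic_block True (Suc (max a b)))"
    by simp
  ultimately show "\<exists>n. shiftp n ` U \<inter> V \<noteq> {}" by (metis IntI empty_iff imageI)
qed

lemma finite_closed_invariant:
  assumes A: "A \<subset> cam_shift" "closed A" "\<And>n x. x \<in> A \<Longrightarrow> shiftp n x \<in> A"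
  shows "finite A"
proof -
  obtain z where z: "z \<in> cam_shift" "z \<notin> A" using A(1) by blast
  then obtain k where k: "\<And>y. agree k z y \<Longrightarrow> y \<notin> A"
    using A(2) open_iff_agree[of "- A"] by (auto simp: closed_def)
  obtain d i j where zp: "agree k z (shiftp j (periodic_block d i))" using z cam_shift_iff by blast
  obtain n where n: "\<And>m c x t. n \<le> m \<Longrightarrow> occurs x t (block (Suc m) c) \<Longrightarrow>
      \<exists>t'. agree k (shiftp t' x) (shiftp j (periodic_block d i))"
    by (rule visits[of k j i d]) blast
  define r where "r = Suc n"
  have nolevel: "\<not> level r x t" if x: "x \<in> A" for x t
  proof
    assume "level r x t"
    then obtain c where "occurs x t (block (Suc n) c)" by (auto simp: level_def r_def)
    from n[OF order_refl this] obtain t' where "agree k (shiftp t' x) (shiftp j (periodic_block d i))" by blast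
    then have "shiftp t' x \<notin> A" using k agree_trans[OF zp] agree_sym by blast
    then show False using A(3)[OF x] by blast
  qed
  define F where "F = (\<Union>c. \<Union>m\<in>{..<r}. orbit (periodic_block c m))"
  have finF: "finite F" unfolding F_def using finite_orbit_periodic_block by auto
  have "A \<subseteq> F"
  proof
    fix x assume x: "x \<in> A"
    have "\<exists>y\<in>F. agree k x y" for k
    proof -
      \<comment> \<open>The margin of one word of level \<open>r\<close> excludes any such word over
        the origin and pushes the flanks of a periodic stretch so far out that the stretch contains
        the whole window of radius \<open>k\<close>.\<close>
      define k' where "k' = \<bar>k\<bar> + int (block_len r) + 1"
      obtain c m a where y: "agree k' x (shiftp a (periodic_block c m))"
        using x A(1) cam_shift_iff by blast
      \<comment> \<open>The approximating periodic point inherits from \<open>x\<close> the absence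
        of words of level \<open>r\<close> inside the window, and it is the point whose structure is
        known.\<close>
      have nolev: "\<not> level r (periodic_block c m) (a + t)" if t: "- k' \<le> t" "t + int (block_len r) \<le> k'" for t
      proof
        assume "level r (periodic_block c m) (a + t)"
        then obtain c' where c': "occurs (periodic_block c m) (a + t) (block r c')" by (auto simp: level_def)
        have "x (t + int s) = block r c' ! s" if s: "s < block_len r" for s
        proof -
          have "x (t + int s) = periodic_block c m (t + int s + a)"
            using y t s by (auto simp: agree_def shiftp_def)
          also have "\<dots> = periodic_block c m (a + t + int s)" by (simp add: algebra_simps)
          also have "\<dots> = block r c' ! s" using c' s by (simp add: occurs_def)
          finally show ?thesis .
        qed
        then have "occurs x t (block r c')" by (simp add: occurs_def)
        then show False using nolevel[OF x, of t] by (auto simp: level_def)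
      qed
      have far: "s - a < - k' \<or> k' < s - a + int (block_len r)" if "level r (periodic_block c m) s" for s
      proof -
        have "\<not> (- k' \<le> s - a \<and> s - a + int (block_len r) \<le> k')"
          using nolev[of "s - a"] that by auto
        then show ?thesis by linarith
      qed
      show ?thesis
      proof (cases "m < r")
        case True
        then have "shiftp a (periodic_block c m) \<in> F" by (auto simp: F_def orbit_def)
        moreover have "agree k x (shiftp a (periodic_block c m))" by (rule agree_mono[OF y]) (simp add: k'_def)
        ultimately show ?thesis by blast
      next
        case False
        then have cov: "covered r (periodic_block c m) a" by (intro periodic_block_covered) simp
        have "\<not> (\<exists>s. level r (periodic_block c m) s \<and> s \<le> a \<and> a < s + int (block_len r))"
        proof
          assume "\<exists>s. level r (periodic_block c m) s \<and> s \<le> a \<and> a < s + int (block_len r)"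
          then obtain s where "level r (periodic_block c m) s" "s \<le> a" "a < s + int (block_len r)" by blast
          then show False using far[of s] unfolding k'_def by linarith
        qed
        then obtain s e i d b where I: "i < r" "s \<le> a" "a < e"
          "level r (periodic_block c m) (s - int (block_len r))" "level r (periodic_block c m) e"
          "\<And>k. s \<le> k \<Longrightarrow> k < e \<Longrightarrow> periodic_block c m k = periodic_block d i (k + b)"
          using cov unfolding covered_def by blast
        have s: "s - a < - \<bar>k\<bar>"
          using far[OF I(4)] I(2) unfolding k'_def by linarith
        have e: "\<bar>k\<bar> < e - a"
          using far[OF I(5)] I(3) unfolding k'_def by linarith
        have "agree k x (shiftp (a + b) (periodic_block d i))"
          unfolding agree_def
        proof (intro allI impI)
          fix q assume q: "\<bar>q\<bar> \<le> k"
          have "x q = periodic_block c m (q + a)"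
            using y q by (auto simp: agree_def shiftp_def k'_def)
          also have "\<dots> = periodic_block d i (q + a + b)"
            using s e q by (intro I(6)) auto
          finally show "x q = shiftp (a + b) (periodic_block d i) q"
            by (simp add: shiftp_def algebra_simps)
        qed
        moreover have "shiftp (a + b) (periodic_block d i) \<in> F" using I(1) by (auto simp: F_def orbit_def)
        ultimately show ?thesis by blast
      qed
    qed
    \<comment> \<open>The approximations of \<open>x\<close> vary with the window, but they all lie
      in the finite, hence closed, set \<open>F\<close>.\<close>
    then have "x \<in> closure F" by (simp add: closure_iff_agree)
    then show "x \<in> F" using closed_finite_full_shift[OF finF] by simp
  qed
  then show ?thesis using finF finite_subset by blast
qed

lemma dense_periodic_cam_shift: "cam_shift \<subseteq> closure (periodic_points cam_shift)"
proof -
  have "orbit (shiftp j x) = orbit x" for j x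
  proof -
    have "shiftp n x \<in> range (\<lambda>n. shiftp (n + j) x)" for n
      by (rule image_eqI[of _ _ "n - j"]) auto
    then show ?thesis by (auto simp: orbit_def)
  qed
  then have "orbit (periodic_block c n) \<subseteq> periodic_points cam_shift" for c n
    using periodic_block_cam_shift finite_orbit_periodic_block by (auto simp: periodic_points_def orbit_def)
  then show ?thesis unfolding cam_shift_def by (intro closure_mono) (auto simp: cam_shift_def)
qed

text \<open>The spacer contains \<open>Suc n\<close> consecutive ones and also zeros. A period of at
  most \<open>Suc n\<close> would propagate the run of ones to every position.\<close>

lemma periodic_block_not_periodic:
  assumes "0 < q" "q \<le> Suc n"
  shows "\<exists>j. periodic_block c (Suc n) (j + int q) \<noteq> periodic_block c (Suc n) j"
proof (rule ccontr)
  assume "\<not> ?thesis"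
  then have per: "periodic_block c (Suc n) (j + int q) = periodic_block c (Suc n) j" for j by blast
  have mult: "periodic_block c (Suc n) (j + int q * int a) = periodic_block c (Suc n) j" for j a
  proof (induction a)
    case (Suc a)
    then show ?case using per[of "j + int q * int a"] by (simp add: algebra_simps)
  qed simp
  have run: "\<exists>t. \<forall>k. 0 \<le> k \<and> k < int (Suc n) \<longrightarrow> periodic_block c (Suc n) (t + k) = d" for d
  proof -
    obtain t where "occurs (periodic_block c (Suc n)) t (list_power (Suc n) (block 0 d))"
      by (rule occurs_block_Suc_list_power[OF occurs_periodic_block le0])
    from occurs_list_power_per[OF this] show ?thesis by (auto simp: per_def)
  qed
  obtain s where s: "\<And>k. 0 \<le> k \<Longrightarrow> k < int (Suc n) \<Longrightarrow> periodic_block c (Suc n) (s + k) = True"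
    using run[of True] by auto
  obtain t where t: "periodic_block c (Suc n) t = False"
    using run[of False] by force
  \<comment> \<open>Selects the position in the run of ones that is congruent to \<open>t\<close>
    modulo \<open>q\<close>.\<close>
  define k where "k = (t - s) mod int q"
  have k: "0 \<le> k" "k < int (Suc n)" using assms by (auto simp: k_def intro: order_less_le_trans[OF pos_mod_bound])
  have tk: "t = s + k + int q * ((t - s) div int q)"
    by (simp add: k_def)
  have "periodic_block c (Suc n) t = periodic_block c (Suc n) (s + k)"
  proof (cases "0 \<le> (t - s) div int q")
    case True
    then show ?thesis using mult[of "s + k" "nat ((t - s) div int q)"] tk by simp
  next
    case False
    then have "periodic_block c (Suc n) (t - int q * ((t - s) div int q)) = periodic_block c (Suc n) t"
      using mult[of t "nat (- ((t - s) div int q))"] by simp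
    moreover have "t - int q * ((t - s) div int q) = s + k" using tk by linarith
    ultimately show ?thesis by simp
  qed
  then show False using s[OF k] t by simp
qed

section \<open>Frequencies along the periodic orbits\<close>

lemma sum_lessThan_add:
  fixes f :: "nat \<Rightarrow> real"
  shows "(\<Sum>j<a + b. f j) = (\<Sum>j<a. f j) + (\<Sum>j<b. f (a + j))"
  by (induction b) (simp_all add: add.assoc)

lemma periodic_sum_mult:
  fixes f :: "int \<Rightarrow> real"
  assumes "\<And>k. f (k + int l) = f k"
  shows "(\<Sum>j<k * l. f (int j)) = real k * (\<Sum>j<l. f (int j))"
proof (induction k)
  case (Suc k)
  have "(\<Sum>j<Suc k * l. f (int j)) = (\<Sum>j<k * l + l. f (int j))"
    by (simp add: add.commute)
  also have "\<dots> = real k * (\<Sum>j<l. f (int j)) + (\<Sum>j<l. f (int j + int (k * l)))"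
    by (simp only: sum_lessThan_add Suc.IH of_nat_add add.commute[of _ "int (k * l)"])
  also have "(\<Sum>j<l. f (int j + int (k * l))) = (\<Sum>j<l. f (int j))"
    using assms by (rule periodic_sum_shift)
  finally show ?case by (simp add: algebra_simps)
qed simp

text \<open>Along the initial power the two periodic points coincide, so \<open>U\<close> is seen
  equally by both unless the window of radius \<open>2 * block_len m\<close> leaves the power. That
  affects at most \<open>2 * block_len m\<close> positions at each end; the positions of the spacer
  are all counted as bad.\<close>

lemma sum_unlike_Suc:
  assumes U: "U \<in> local_sets (2 * int (block_len m))"
  shows "(\<Sum>j<block_len (Suc m). indicator U (shiftp (int j) (periodic_block c (Suc m))) :: real) \<le>
    real (repetitions m) * (\<Sum>j<block_len m. indicator U (shiftp (int j) (periodic_block c m)))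
      + real (4 * block_len m + length (spacer m))"
proof -
  define L R where "L = block_len m" and "R = repetitions m * block_len m"
  define f g where "f = (\<lambda>j::nat. indicator U (shiftp (int j) (periodic_block c (Suc m))) :: real)"
    and "g = (\<lambda>j::int. indicator U (shiftp j (periodic_block c m)) :: real)"
  have f1: "f j \<le> 1" for j by (simp add: f_def indicator_def)
  have g0: "0 \<le> g j" for j by (simp add: g_def)
  have "occurs (periodic_block c (Suc m)) 0 (list_power (repetitions m) (block m c))"
    using occurs_periodic_block[of "Suc m" c] by (simp add: block_Suc occurs_append)
  from occurs_list_power_per[OF this] have eq: "periodic_block c (Suc m) j = periodic_block c m j" if "0 \<le> j" "j < int R" for j
    using that by (simp add: R_def)
  have fg: "f j \<le> g (int j) + (indicator {..<2 * L} j + indicator {R - 2 * L..} j)" if "j < R" for j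
  proof (cases "j < 2 * L \<or> R - 2 * L \<le> j")
    case True
    then have "1 \<le> (indicator {..<2 * L} j + indicator {R - 2 * L..} j :: real)"
      using that by (auto simp: indicator_def)
    then show ?thesis using f1[of j] g0[of "int j"] by linarith
  next
    case False
    have "agree (2 * int L) (shiftp (int j) (periodic_block c (Suc m))) (shiftp (int j) (periodic_block c m))"
      unfolding agree_def shiftp_def using False by (intro allI impI eq) auto
    then have "f j = g (int j)"
      using local_setsD[OF U] by (simp add: f_def g_def L_def indicator_def)
    then show ?thesis by simp
  qed
  have "(\<Sum>j<block_len (Suc m). f j) = (\<Sum>j<R. f j) + (\<Sum>j<length (spacer m). f (R + j))"
    by (simp only: block_len_Suc R_def sum_lessThan_add)
  also have "(\<Sum>j<length (spacer m). f (R + j)) \<le> real (length (spacer m))"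
    using sum_mono[of "{..<length (spacer m)}" "\<lambda>j. f (R + j)" "\<lambda>_. 1"] f1 by simp
  also have "(\<Sum>j<R. f j) \<le>
      (\<Sum>j<R. g (int j) + (indicator {..<2 * L} j + indicator {R - 2 * L..} j))"
    by (intro sum_mono fg) simp
  also have "\<dots> = (\<Sum>j<R. g (int j)) + real (card ({..<R} \<inter> {..<2 * L})) + real (card ({..<R} \<inter> {R - 2 * L..}))"
    by (simp add: sum.distrib indicator_def Int_def if_distrib sum.If_cases cong: if_cong)
  also have "(\<Sum>j<R. g (int j)) = real (repetitions m) * (\<Sum>j<L. g (int j))"
    unfolding R_def L_def
  proof (rule periodic_sum_mult)
    show "g (k + int (block_len m)) = g k" for k
      using arg_cong[OF shiftp_periodic_block, of "shiftp k" m c] by (simp add: g_def)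
  qed
  also have "card ({..<R} \<inter> {..<2 * L}) \<le> 2 * L"
    using card_mono[of "{..<2 * L}" "{..<R} \<inter> {..<2 * L}"] by simp
  also have "card ({..<R} \<inter> {R - 2 * L..}) \<le> 2 * L"
  proof -
    have "{..<R} \<inter> {R - 2 * L..} = {R - 2 * L..<R}" by auto
    then show ?thesis by simp
  qed
  finally show ?thesis by (simp add: f_def g_def L_def)
qed

text \<open>The geometric tail: the sum of \<open>1 / 4 ^ Suc m\<close> over all
  \<open>m \<ge> n\<close> is \<open>1 / (3 * 4 ^ n)\<close>, here divided by
  \<open>block_len n\<close>.\<close>

definition approx_err :: "nat \<Rightarrow> real" where
  "approx_err n = 1 / (3 * 4 ^ n * real (block_len n))"

text \<open>Passing from level \<open>m\<close> to \<open>Suc m\<close> adds at most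
  \<open>E\<close> bad positions, while the new word has length at least
  \<open>4 ^ Suc m * E * block_len m\<close>. The density of bad positions thus grows by at most
  \<open>1 / (4 ^ Suc m * block_len n)\<close>.\<close>

lemma sum_unlike_le:
  assumes "n \<le> m"
  shows "(\<Sum>j<block_len m. indicator (unlike (periodic_block c n) (block_len n)) (shiftp (int j) (periodic_block c m)))
    \<le> (1 / 4 ^ n - 1 / 4 ^ m) / (3 * real (block_len n)) * real (block_len m)"
  using assms
proof (induction m rule: dec_induct)
  case base
  have "shiftp (int j) (periodic_block c n) \<notin> unlike (periodic_block c n) (block_len n)" for j
    by (auto simp: unlike_def intro: agree_refl)
  then show ?case by simp
next
  case (step m)
  define U where "U = unlike (periodic_block c n) (block_len n)"
  define E where "E = real (4 * block_len m + length (spacer m))"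
  define b where "b = (1 / 4 ^ n - 1 / 4 ^ m) / (3 * real (block_len n))"
  define b' where "b' = (1 / 4 ^ n - 1 / 4 ^ Suc m) / (3 * real (block_len n))"
  have mono: "block_len n \<le> block_len m" by (rule block_len_mono[OF step(1)])
  have pos: "0 < real (block_len n)" using block_len_pos by simp
  have K: "real (repetitions m) = 4 ^ Suc m * E" by (simp add: repetitions_def E_def)
  have b': "b' = b + 1 / (4 ^ Suc m * real (block_len n))"
    using pos by (simp add: b_def b'_def field_simps)
  have "(1::real) / 4 ^ Suc m \<le> 1 / 4 ^ n"
    using step(1) by (intro divide_left_mono power_increasing) auto
  then have b'0: "0 \<le> b'"
    using pos unfolding b'_def by (intro divide_nonneg_nonneg) auto
  have "U \<in> local_sets (2 * int (block_len m))"
    unfolding U_def using mono by (intro local_sets_mono[OF unlike_local]) simp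
  from sum_unlike_Suc[OF this, of c]
  have "(\<Sum>j<block_len (Suc m). indicator U (shiftp (int j) (periodic_block c (Suc m)))) \<le>
      real (repetitions m) * (\<Sum>j<block_len m. indicator U (shiftp (int j) (periodic_block c m))) + E"
    by (simp add: E_def)
  also have "\<dots> \<le> real (repetitions m) * (b * real (block_len m)) + E"
    using step.IH by (intro add_right_mono mult_left_mono) (auto simp: U_def b_def)
  \<comment> \<open>Enlarging \<open>E\<close> by a ratio that is at least 1 gives both terms the
    same factor, so that together they form exactly \<open>b'\<close>.\<close>
  also have "\<dots> \<le> real (repetitions m) * (b * real (block_len m)) + E * (real (block_len m) / real (block_len n))"
    using mono pos mult_left_mono[of 1 "real (block_len m) / real (block_len n)" E] by (simp add: E_def)
  also have "\<dots> = b' * (real (repetitions m) * real (block_len m))"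
    using pos by (simp add: b' K field_simps)
  also have "\<dots> \<le> b' * real (block_len (Suc m))"
    using b'0 by (intro mult_left_mono) (auto simp: block_len_Suc)
  finally show ?case by (simp only: U_def b'_def)
qed

lemma freq_unlike_le:
  assumes "n \<le> m"
  shows "freq (periodic_block c m) (block_len m) (unlike (periodic_block c n) (block_len n)) \<le> approx_err n"
proof -
  have "freq (periodic_block c m) (block_len m) (unlike (periodic_block c n) (block_len n)) \<le> (1 / 4 ^ n - 1 / 4 ^ m) / (3 * real (block_len n))"
    using sum_unlike_le[OF assms, of c] block_len_pos[of m] by (simp add: freq_def divide_le_eq)
  also have "\<dots> \<le> (1 / 4 ^ n) / (3 * real (block_len n))"
    by (intro divide_right_mono) auto
  also have "\<dots> = approx_err n" by (simp add: approx_err_def mult.assoc mult.left_commute)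
  finally show ?thesis .
qed

lemma approx_err_less: "approx_err n < 1 / real (block_len n)"
proof -
  have "1 * real (block_len n) < 3 * 4 ^ n * real (block_len n)"
    using block_len_pos[of n] one_le_power[of "4::real" n] by (intro mult_strict_right_mono) linarith+
  then show ?thesis using block_len_pos[of n] by (simp add: approx_err_def frac_less2)
qed

lemma approx_err_tendsto: "approx_err \<longlonglongrightarrow> 0"
proof (rule tendsto_sandwich[OF _ _ tendsto_const LIMSEQ_inverse_real_of_nat])
  show "\<forall>\<^sub>F n in sequentially. 0 \<le> approx_err n" by (simp add: approx_err_def)
  have "approx_err n \<le> inverse (real (Suc n))" for n
  proof -
    have "1 * real (Suc n) \<le> 3 * 4 ^ n * real (block_len n)"
      using less_block_len[of n] one_le_power[of "4::real" n] by (intro mult_mono) linarith+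
    then show ?thesis unfolding approx_err_def inverse_eq_divide
      using less_block_len[of n] by (intro divide_left_mono) auto
  qed
  then show "\<forall>\<^sub>F n in sequentially. approx_err n \<le> inverse (real (Suc n))" by simp
qed

lemma periodic_approximation_periodic_block: "periodic_approximation (periodic_block c) block_len approx_err"
proof
  show "\<exists>n\<ge>q. approx_err n < 1 / real (block_len n) \<and> (\<exists>j. periodic_block c n (j + int q) \<noteq> periodic_block c n j)" if "0 < q" for q
    using that approx_err_less[of "Suc q"] periodic_block_not_periodic[of q q c] by (intro exI[of _ "Suc q"]) auto
qed (auto intro: shiftp_periodic_block less_block_len approx_err_tendsto freq_unlike_le)

section \<open>The main theorem\<close>

lemma faithful_cam_shift: "faithful cam_shift"
  unfolding faithful_def
proof (intro allI impI)
  fix n :: int assume triv: "\<forall>x\<in>cam_shift. shiftp n x = x"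
  show "n = 0"
  proof (rule ccontr)
    assume "n \<noteq> 0"
    define q where "q = nat \<bar>n\<bar>"
    have q: "0 < q" using \<open>n \<noteq> 0\<close> by (simp add: q_def)
    define x where "x = periodic_block True (Suc q)"
    have "shiftp n (shiftp j x) = shiftp j x" for j
      using triv periodic_block_cam_shift by (simp add: x_def del: shiftp_shiftp)
    \<comment> \<open>The two instances give the periods \<open>n\<close> and \<open>- n\<close>,
      one of which is the positive number \<open>q\<close>.\<close>
    from this[of 0] this[of "- n"] have "shiftp (int q) x = x"
      by (cases "0 \<le> n") (simp_all add: q_def)
    then have "x (j + int q) = x j" for j
      by (metis shiftp_def)
    then show False using periodic_block_not_periodic[OF q, of q True] by (simp add: x_def)
  qed
qed

lemma CAM_cam_shift: "CAM cam_shift"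
  unfolding CAM_def
  using top_transitive_cam_shift faithful_cam_shift dense_periodic_cam_shift finite_closed_invariant
  by (auto simp: image_subset_iff)

text \<open>At level 0 the periodic point is constant, so the frequency of 1 is exactly
  \<open>of_bool c\<close>, and \<open>approx_err 0\<close> is 1/3.\<close>

lemma ergodic_measure_cam_shift:
  obtains \<mu> where "ergodic_nonatomic_on cam_shift \<mu>" "\<bar>measure \<mu> {x\<in>cam_shift. x 0} - of_bool c\<bar> \<le> 1 / 3"
proof -
  interpret periodic_approximation "periodic_block c" block_len approx_err by (rule periodic_approximation_periodic_block)
  obtain M where "periodic_limit_measure (periodic_block c) block_len approx_err M" by (rule limit_measure_exists)
  then interpret M: periodic_limit_measure "periodic_block c" block_len approx_err M .
  have XM: "cam_shift \<in> sets M" using closed_cam_shift by (simp add: M.sets_M)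
  have "{x. x 0} \<in> local_sets (int (block_len 0))"
    by (auto simp: local_sets_def agree_def)
  from M.measure_close[OF this]
  have "\<bar>measure M {x. x 0} - of_bool c\<bar> \<le> 1 / 3"
    by (simp add: freq_def approx_err_def shiftp_def per_def indicator_def of_bool_def split: if_splits)
  moreover have "measure M {x. x 0} = measure (restrict_space M cam_shift) {x\<in>cam_shift. x 0}"
  proof -
    have "measure M {x. x 0} = measure M {x\<in>cam_shift. x 0}"
    proof (rule measure_eq_AE)
      have "measure M cam_shift = 1" by (rule M.measure_closed_support[OF closed_cam_shift periodic_block_cam_shift])
      then show "AE x in M. x \<in> {x. x 0} \<longleftrightarrow> x \<in> {x \<in> cam_shift. x 0}"
        using M.AE_in_set_eq_1[OF XM] by auto
      show S: "{x :: int \<Rightarrow> bool. x 0} \<in> sets M"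
        by (rule M.clopens_sets) (auto simp: clopens_def local_sets_def agree_def intro!: exI[of _ 0])
      have "{x \<in> cam_shift. x 0} = cam_shift \<inter> {x. x 0}" by blast
      then show "{x \<in> cam_shift. x 0} \<in> sets M" using sets.Int[OF XM S] by simp
    qed
    also have "\<dots> = measure (restrict_space M cam_shift) {x\<in>cam_shift. x 0}"
      using XM by (subst measure_restrict_space) (auto simp: M.space_M)
    finally show ?thesis .
  qed
  moreover have "ergodic_nonatomic_on cam_shift (restrict_space M cam_shift)"
    using shiftp_cam_shift_iff by (intro M.ergodic_nonatomic_restrict closed_cam_shift periodic_block_cam_shift) auto
  ultimately show ?thesis using that by simp
qed

theorem theorem1p1:
  shows "\<exists>X. subshift X \<and> CAM X \<and>
           (\<exists>\<mu> \<nu>. ergodic_nonatomic_on X \<mu> \<and> ergodic_nonatomic_on X \<nu> \<and> \<mu> \<noteq> \<nu>)"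
proof -
  obtain \<mu> where \<mu>: "ergodic_nonatomic_on cam_shift \<mu>" "\<bar>measure \<mu> {x\<in>cam_shift. x 0} - of_bool True\<bar> \<le> 1 / 3"
    by (rule ergodic_measure_cam_shift)
  obtain \<nu> where \<nu>: "ergodic_nonatomic_on cam_shift \<nu>" "\<bar>measure \<nu> {x\<in>cam_shift. x 0} - of_bool False\<bar> \<le> 1 / 3"
    by (rule ergodic_measure_cam_shift)
  \<comment> \<open>The points with a 1 at the origin have mass at least 2/3 under
    \<open>\<mu>\<close> and at most 1/3 under \<open>\<nu>\<close>.\<close>
  have "\<mu> \<noteq> \<nu>" using \<mu>(2) \<nu>(2) by auto
  then show ?thesis using subshift_cam_shift CAM_cam_shift \<mu>(1) \<nu>(1) by blast
qed

end
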